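(* For every finite, connected, loopless multigraph $G$ and every integer $r \geq 1$, one has \[ \operatorname{dgon}_r(\Gamma(G)) = \min_{k \in \mathbb{N}_1} \operatorname{dgon}_r(\sigma_k(G)), \] where $\mathbb{N}_1 = \{1,2,3,\dots\}$.
   Context: A graph is a finite, connected, loopless multigraph (parallel edges allowed). A divisor on a graph $G$ is a formal sum $\sum_{v\in V(G)} a_v v$ with $a_v\in\mathbb{Z}$; its degree is $\sum_v a_v$, and it is effective if all $a_v \geq 0$. With $L_G$ the Laplacian matrix of $G$, the principal divisors are the divisors $L_G x$ for $x\in\mathbb{Z}^{V(G)}$, and two divisors are equivalent if their difference is principal. The rank of a divisor $D$ is the largest integer $k$ such that $D-E$ is equivalent to an effective divisor for every effective divisor $E$ of degree $k$ (it is $-1$ if $D$ is not equivalent to an effective divisor). The $r$-th divisorial gonality $\operatorname{dgon}_r(G)$ is the minimum degree of a divisor of rank $r$ on $G$. For $k\ge 1$, $\sigma_k(G)$ denotes the multigraph obtained from $G$ by subdividing every edge into $k$ edges (i.e. replacing each edge by a path of length $k$). A metric graph $\Gamma(G,\ell)$, for a multigraph $G$ and lengths $\ell\colon E(G)\to\mathbb{R}_{>0}$, is obtained by taking a closed interval $[0,\ell(e)]$ for each edge $e$ and gluing endpoints as prescribed by $G$, with the shortest path metric; $\Gamma(G):=\Gamma(G,\mathbb{1})$ uses unit lengths. A divisor on a metric graph $\Gamma$ is a finitely supported formal $\mathbb{Z}$-combination of points of $\Gamma$ (degree, effectivity as before). A rational function on $\Gamma$ is a continuous piecewise linear $f\colon\Gamma\to\mathbb{R}$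 with integer slopes; its principal divisor assigns to each point $v$ the sum of the outgoing slopes of $f$ along all directions emanating from $v$. Divisors are equivalent if their difference is principal; rank and $\operatorname{dgon}_r(\Gamma)$ (minimum degree of a divisor of rank $r$ on $\Gamma$) are defined as in the discrete case, using effective divisors on $\Gamma$. *)

theory Defs
  imports
    "HOL-Analysis.Analysis"
    "HOL-Library.Poly_Mapping"
    "Graph_Theory.Digraph_Component"
begin

text \<open>
  A multigraph is represented by a digraph in which every arc stands for one undirected edge with an
  arbitrary reference orientation; parallel and antiparallel arcs are allowed and represent
  parallel edges. The orientation only serves to parametrise the edges.
\<close>


subsection \<open>Divisors, rank and gonality\<close>

text \<open>
  The divisor theory is the same for finite graphs and metric graphs. It is parametrised by the set
  \<open>P\<close> of points and the set \<open>Prin\<close> of principal divisors.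
\<close>

type_synonym 'p divisor = "'p \<Rightarrow>\<^sub>0 int"

definition divisors :: "'p set \<Rightarrow> 'p divisor set" where
  "divisors P = {D. Poly_Mapping.keys D \<subseteq> P}"

definition div_degree :: "'p divisor \<Rightarrow> int" where
  "div_degree D = (\<Sum>p\<in>Poly_Mapping.keys D. Poly_Mapping.lookup D p)"

definition effective :: "'p divisor \<Rightarrow> bool" where
  "effective D \<longleftrightarrow> (\<forall>p. 0 \<le> Poly_Mapping.lookup D p)"

definition equivalent :: "'p divisor set \<Rightarrow> 'p divisor \<Rightarrow> 'p divisor \<Rightarrow> bool" where
  "equivalent Prin D D' \<longleftrightarrow> D - D' \<in> Prin"

text \<open>
  For \<open>k < 0\<close> the condition below is vacuous, and for \<open>k = 0\<close> it says that \<open>D\<close> is equivalent to an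
  effective divisor; so the rank is \<open>-1\<close> if \<open>D\<close> is not equivalent to an effective divisor.
\<close>

definition div_rank :: "'p set \<Rightarrow> 'p divisor set \<Rightarrow> 'p divisor \<Rightarrow> int" where
  "div_rank P Prin D =
     (GREATEST k. \<forall>E \<in> divisors P. effective E \<and> div_degree E = k \<longrightarrow>
        (\<exists>F \<in> divisors P. effective F \<and> equivalent Prin (D - E) F))"

definition dgon :: "'p set \<Rightarrow> 'p divisor set \<Rightarrow> int \<Rightarrow> int" where
  "dgon P Prin r = (LEAST d. \<exists>D \<in> divisors P. div_rank P Prin D = r \<and> div_degree D = d)"


subsection \<open>Finite graphs\<close>

definition laplacian :: "('a, 'b) pre_digraph \<Rightarrow> 'a \<Rightarrow> 'a \<Rightarrow> int" where
  "laplacian G u v =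
     (if u = v then int (card {e \<in> arcs G. tail G e = u \<or> head G e = u})
      else - int (card {e \<in> arcs G. {tail G e, head G e} = {u, v}}))"

definition principal_divisors :: "('a, 'b) pre_digraph \<Rightarrow> 'a divisor set" where
  "principal_divisors G =
     {D \<in> divisors (verts G).
        \<exists>x :: 'a \<Rightarrow> int. \<forall>u \<in> verts G. Poly_Mapping.lookup D u = (\<Sum>v\<in>verts G. laplacian G u v * x v)}"

definition graph_dgon :: "('a, 'b) pre_digraph \<Rightarrow> int \<Rightarrow> int" where
  "graph_dgon G r = dgon (verts G) (principal_divisors G) r"

text \<open>
  In \<open>subdivide_edges k G\<close> the edge \<open>e\<close> becomes the path with vertices
  \<open>subdivision_vertex k G e i\<close> for \<open>i = 0, \<dots>, k\<close>, where \<open>i = 0\<close> is the tail of \<open>e\<close> and \<open>i = k\<close> its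
  head; its \<open>i\<close>-th edge is \<open>(e, i)\<close> for \<open>i < k\<close>.
\<close>

definition subdivision_vertex ::
  "nat \<Rightarrow> ('a, 'b) pre_digraph \<Rightarrow> 'b \<Rightarrow> nat \<Rightarrow> 'a + 'b \<times> nat" where
  "subdivision_vertex k G e i =
     (if i = 0 then Inl (tail G e) else if i = k then Inl (head G e) else Inr (e, i))"

definition subdivide_edges ::
  "nat \<Rightarrow> ('a, 'b) pre_digraph \<Rightarrow> ('a + 'b \<times> nat, 'b \<times> nat) pre_digraph" where
  "subdivide_edges k G =
     \<lparr> verts = Inl ` verts G \<union> {Inr (e, i) | e i. e \<in> arcs G \<and> 0 < i \<and> i < k},
       arcs = arcs G \<times> {..<k},
       tail = (\<lambda>(e, i). subdivision_vertex k G e i),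
       head = (\<lambda>(e, i). subdivision_vertex k G e (Suc i)) \<rparr>"


subsection \<open>Metric graphs\<close>

text \<open>
  The points of \<open>\<Gamma>(G, l)\<close> are the vertices of \<open>G\<close> together with the interior points \<open>(e, t)\<close>,
  \<open>0 < t < l e\<close>, of the edges. The gluing map from the disjoint union of the intervals \<open>{0..l e}\<close> is
  \<open>edge_point\<close>.
\<close>

type_synonym ('a, 'b) mpoint = "'a + 'b \<times> real"

definition points :: "('a, 'b) pre_digraph \<Rightarrow> ('b \<Rightarrow> real) \<Rightarrow> ('a, 'b) mpoint set" where
  "points G l = Inl ` verts G \<union> {Inr (e, t) | e t. e \<in> arcs G \<and> 0 < t \<and> t < l e}"

definition edge_point ::
  "('a, 'b) pre_digraph \<Rightarrow> ('b \<Rightarrow> real) \<Rightarrow> 'b \<Rightarrow> real \<Rightarrow> ('a, 'b) mpoint" where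
  "edge_point G l e t =
     (if t = 0 then Inl (tail G e) else if t = l e then Inl (head G e) else Inr (e, t))"

text \<open>
  \<open>path_length G l p q L\<close>: there is a path of length \<open>L\<close> from \<open>p\<close> to \<open>q\<close> that is a concatenation of
  finitely many segments, each contained in an edge.
\<close>

inductive path_length ::
  "('a, 'b) pre_digraph \<Rightarrow> ('b \<Rightarrow> real) \<Rightarrow> ('a, 'b) mpoint \<Rightarrow> ('a, 'b) mpoint \<Rightarrow> real \<Rightarrow> bool"
  for G l p where
  refl: "p \<in> points G l \<Longrightarrow> path_length G l p p 0"
| step: "path_length G l p (edge_point G l e s) L \<Longrightarrow> e \<in> arcs G \<Longrightarrow> s \<in> {0..l e} \<Longrightarrow> t \<in> {0..l e} \<Longrightarrow>
    path_length G l p (edge_point G l e t) (L + \<bar>t - s\<bar>)"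

definition path_dist ::
  "('a, 'b) pre_digraph \<Rightarrow> ('b \<Rightarrow> real) \<Rightarrow> ('a, 'b) mpoint \<Rightarrow> ('a, 'b) mpoint \<Rightarrow> real" where
  "path_dist G l p q =
     (if p \<in> points G l \<and> q \<in> points G l then Inf {L. path_length G l p q L} else 0)"

lemma edge_point_in_points:
  assumes "wf_digraph G" "e \<in> arcs G" "t \<in> {0..l e}"
  shows "edge_point G l e t \<in> points G l"
  using assms by (auto simp: edge_point_def points_def wf_digraph_def)

lemma path_length_in_points:
  assumes "path_length G l p q L" "wf_digraph G"
  shows "p \<in> points G l" "q \<in> points G l" "0 \<le> L"
  using assms by (induction rule: path_length.induct) (auto intro: edge_point_in_points)

lemma path_length_segment:
  assumes "wf_digraph G" "e \<in> arcs G" "s \<in> {0..l e}" "t \<in> {0..l e}"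
  shows "path_length G l (edge_point G l e s) (edge_point G l e t) \<bar>t - s\<bar>"
  using path_length.step[OF path_length.refl, OF edge_point_in_points assms(2)] assms by fastforce

lemma path_length_trans:
  assumes "path_length G l q r L'" "path_length G l p q L"
  shows "path_length G l p r (L + L')"
  using assms
proof (induction rule: path_length.induct)
  case refl
  then show ?case by simp
next
  case (step e s L' t)
  then show ?case
    using path_length.step[where l = l and p = p and L = "L + L'" and t = t] by (simp add: add.assoc)
qed

lemma path_length_sym:
  assumes "path_length G l p q L" "wf_digraph G"
  shows "path_length G l q p L"
  using assms
proof (induction rule: path_length.induct)
  case refl
  then show ?case by (auto intro: path_length.refl)
next
  case (step e s L t)
  then show ?case
    using path_length_trans[of G l "edge_point G l e s" p L "edge_point G l e t" "\<bar>s - t\<bar>"]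
      path_length_segment[of G e t l s]
    by (simp add: abs_minus_commute add.commute)
qed

lemma ex_path_length:
  assumes wf: "wf_digraph G" and con: "Digraph_Component.connected G"
    and pos: "\<And>e. e \<in> arcs G \<Longrightarrow> 0 < l e"
    and p: "p \<in> points G l" and q: "q \<in> points G l"
  shows "\<exists>L. path_length G l p q L"
proof -
  define R where "R p q \<longleftrightarrow> (\<exists>L. path_length G l p q L)" for p q
  have R_trans: "R p r" if "R p q" "R q r" for p q r
    using that path_length_trans unfolding R_def by blast
  have R_sym: "R q p" if "R p q" for p q
    using that path_length_sym wf unfolding R_def by blast
  have R_edge: "R (edge_point G l e s) (edge_point G l e t)"
    if "e \<in> arcs G" "s \<in> {0..l e}" "t \<in> {0..l e}" for e s t
    using path_length_segment[where l = l and s = s and t = t and e = e] wf that unfolding R_def by blast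
  have R_arc: "R (Inl (tail G e)) (Inl (head G e))" if "e \<in> arcs G" for e
    using R_edge[of e 0 "l e"] pos[of e] that by (simp add: edge_point_def)
  have R_vert: "R (Inl u) (Inl v)" if "u \<in> verts G" "v \<in> verts G" for u v
  proof -
    have "u \<rightarrow>\<^sup>*\<^bsub>with_proj (mk_symmetric G)\<^esub> v"
      using con that unfolding Digraph_Component.connected_def strongly_connected_def
      by (simp add: mk_symmetric_def)
    then show ?thesis
      unfolding reachable_def
    proof (induction rule: rtrancl_on_induct)
      case base
      have "Inl u \<in> points G l" using that by (simp add: points_def)
      then show ?case unfolding R_def by (blast intro: path_length.refl)
    next
      case (step y z)
      then obtain e where "e \<in> arcs G"
        "(y = tail G e \<and> z = head G e) \<or> (y = head G e \<and> z = tail G e)"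
        by (auto simp: mk_symmetric_def arcs_ends_def arc_to_ends_def)
      then show ?case using step.IH R_arc R_sym R_trans by blast
    qed
  qed
  have R_to_vert: "\<exists>v\<in>verts G. R x (Inl v)" if x: "x \<in> points G l" for x
  proof (cases x)
    case (Inl v)
    then have "v \<in> verts G" using x by (auto simp: points_def)
    then show ?thesis using R_vert Inl by blast
  next
    case (Inr et)
    then obtain e t where et: "x = Inr (e, t)" "e \<in> arcs G" "0 < t" "t < l e"
      using x by (auto simp: points_def)
    then have "R x (Inl (tail G e))"
      using R_edge[of e t 0] by (simp add: edge_point_def)
    then show ?thesis using wf et by (auto simp: wf_digraph_def)
  qed
  have "R p q" using R_to_vert[OF p] R_to_vert[OF q] R_vert R_trans R_sym by blast
  then show ?thesis by (simp add: R_def)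
qed

lemma path_length_Lipschitz:
  assumes "path_length G l p q L"
    and "\<And>e s t. e \<in> arcs G \<Longrightarrow> s \<in> {0..l e} \<Longrightarrow> t \<in> {0..l e} \<Longrightarrow>
           \<bar>f (edge_point G l e t) - f (edge_point G l e s)\<bar> \<le> M * \<bar>t - s\<bar>"
  shows "\<bar>f q - f p\<bar> \<le> M * (L :: real)"
  using assms(1)
proof (induction rule: path_length.induct)
  case refl
  then show ?case by simp
next
  case (step e s L t)
  have "\<bar>f (edge_point G l e t) - f (edge_point G l e s)\<bar> \<le> M * \<bar>t - s\<bar>"
    using assms(2) step.hyps by blast
  then show ?case using step.IH by (simp add: distrib_left)
qed

lemma path_dist_Lipschitz:
  assumes wf: "wf_digraph G" and con: "Digraph_Component.connected G"
    and pos: "\<And>e. e \<in> arcs G \<Longrightarrow> 0 < l e"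
    and p: "p \<in> points G l" and q: "q \<in> points G l"
    and M: "0 \<le> M"
    and lip: "\<And>e s t. e \<in> arcs G \<Longrightarrow> s \<in> {0..l e} \<Longrightarrow> t \<in> {0..l e} \<Longrightarrow>
           \<bar>f (edge_point G l e t) - f (edge_point G l e s)\<bar> \<le> M * \<bar>t - s\<bar>"
  shows "\<bar>f q - f p\<bar> \<le> M * path_dist G l p q"
proof (cases "M = 0")
  case True
  then show ?thesis
    using ex_path_length[OF wf con pos p q] path_length_Lipschitz[OF _ lip] by fastforce
next
  case False
  then have "M > 0" using M by simp
  have "\<bar>f q - f p\<bar> / M \<le> Inf {L. path_length G l p q L}"
  proof (rule cInf_greatest)
    show "{L. path_length G l p q L} \<noteq> {}" using ex_path_length[OF wf con pos p q] by blast
  next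
    fix L assume "L \<in> {L. path_length G l p q L}"
    then have "\<bar>f q - f p\<bar> \<le> M * L" using path_length_Lipschitz[OF _ lip] by blast
    then show "\<bar>f q - f p\<bar> / M \<le> L" using \<open>M > 0\<close> by (simp add: field_simps)
  qed
  then show ?thesis using \<open>M > 0\<close> p q by (simp add: path_dist_def field_simps)
qed

lemma path_dist_le:
  assumes "wf_digraph G" "path_length G l p q L"
  shows "path_dist G l p q \<le> L"
  using assms path_length_in_points[OF assms(2,1)]
  by (auto simp: path_dist_def intro!: cInf_lower bdd_belowI[of _ 0] dest: path_length_in_points)

lemma path_dist_pos:
  assumes fin: "fin_digraph G" and con: "Digraph_Component.connected G"
    and pos: "\<And>e. e \<in> arcs G \<Longrightarrow> 0 < l e"
    and p: "p \<in> points G l" and q: "q \<in> points G l" and neq: "p \<noteq> q"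
  shows "path_dist G l p q \<noteq> 0"
proof -
  interpret fin_digraph G by (rule fin)
  have wf: "wf_digraph G" ..
  have interior: "path_dist G l x y \<noteq> 0 \<and> path_dist G l y x \<noteq> 0"
    if xy: "x \<in> points G l" "y \<in> points G l" "x \<noteq> y" "x = Inr (e0, t0)" for x y e0 t0
  proof -
    have t0: "0 < t0" "t0 < l e0" using xy by (auto simp: points_def)
    define \<rho> where "\<rho> = min t0 (l e0 - t0)"
    define f where "f = case_sum (\<lambda>_ :: 'a. 0) (\<lambda>(e, t). if e = e0 then max 0 (\<rho> - \<bar>t - t0\<bar>) else 0)"
    have "\<rho> > 0" using t0 by (simp add: \<rho>_def)
    have f_edge: "f (edge_point G l e t) = (if e = e0 then max 0 (\<rho> - \<bar>t - t0\<bar>) else 0)"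
      if "t \<in> {0..l e}" for e t
      using that t0 by (auto simp: f_def edge_point_def \<rho>_def)
    have lip: "\<bar>f (edge_point G l e t) - f (edge_point G l e s)\<bar> \<le> 1 * \<bar>t - s\<bar>"
      if "e \<in> arcs G" "s \<in> {0..l e}" "t \<in> {0..l e}" for e s t
      using that by (auto simp: f_edge)
    have "f x = \<rho>" using xy \<open>\<rho> > 0\<close> by (simp add: f_def)
    moreover have "f y < \<rho>"
      using xy \<open>\<rho> > 0\<close> by (auto simp: f_def split: sum.splits)
    ultimately show ?thesis
      using path_dist_Lipschitz[OF wf con pos xy(1,2) _ lip]
        path_dist_Lipschitz[OF wf con pos xy(2,1) _ lip] by auto
  qed
  show ?thesis
  proof (cases p)
    case (Inr et)
    then show ?thesis using interior[OF p q neq] by (cases et) auto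
  next
    case (Inl u)
    show ?thesis
    proof (cases q)
      case (Inr et)
      then show ?thesis using interior[OF q p neq[symmetric]] by (cases et) auto
    next
      case (Inl v)
      have uv: "u \<noteq> v" using neq \<open>p = Inl u\<close> Inl by auto
      define h where "h w = (if w = u then 1 else 0 :: real)" for w
      define f where "f = case_sum h
        (\<lambda>(e, t). h (tail G e) + (h (head G e) - h (tail G e)) * (t / l e))"
      define M where "M = (\<Sum>e\<in>arcs G. 1 / l e)"
      have M: "1 / l e \<le> M" if "e \<in> arcs G" for e
        unfolding M_def using that pos by (intro member_le_sum) (auto intro: less_imp_le)
      have "0 \<le> M" unfolding M_def using pos by (intro sum_nonneg) (auto intro: less_imp_le)
      have f_edge: "f (edge_point G l e t) = h (tail G e) + (h (head G e) - h (tail G e)) * (t / l e)"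
        if "e \<in> arcs G" for e t
        using pos[OF that] by (auto simp: f_def edge_point_def)
      have lip: "\<bar>f (edge_point G l e t) - f (edge_point G l e s)\<bar> \<le> M * \<bar>t - s\<bar>"
        if e: "e \<in> arcs G" "s \<in> {0..l e}" "t \<in> {0..l e}" for e s t
      proof -
        have "f (edge_point G l e t) - f (edge_point G l e s) =
            (h (head G e) - h (tail G e)) * ((1 / l e) * (t - s))"
          using e by (simp add: f_edge right_diff_distrib diff_divide_distrib)
        then have "\<bar>f (edge_point G l e t) - f (edge_point G l e s)\<bar> =
            \<bar>h (head G e) - h (tail G e)\<bar> * ((1 / l e) * \<bar>t - s\<bar>)"
          using pos[OF e(1)] by (simp add: abs_mult)
        also have "\<dots> \<le> 1 * ((1 / l e) * \<bar>t - s\<bar>)"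
          using pos[OF e(1)] by (intro mult_right_mono) (auto simp: h_def)
        also have "\<dots> \<le> M * \<bar>t - s\<bar>"
          using M[OF e(1)] by (simp only: mult_1) (rule mult_right_mono, auto)
        finally show ?thesis .
      qed
      have "\<bar>f q - f p\<bar> = 1" using \<open>p = Inl u\<close> Inl uv by (simp add: f_def h_def)
      then show ?thesis
        using path_dist_Lipschitz[OF wf con pos p q \<open>0 \<le> M\<close> lip] by auto
    qed
  qed
qed

lemma Metric_space_metric_graph:
  assumes fin: "fin_digraph G" and con: "Digraph_Component.connected G"
    and pos: "\<And>e. e \<in> arcs G \<Longrightarrow> 0 < l e"
  shows "Metric_space (points G l) (path_dist G l)"
proof
  interpret fin_digraph G by (rule fin)
  have wf: "wf_digraph G" ..
  fix x y z
  show "0 \<le> path_dist G l x y"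
    using ex_path_length[where l = l and p = x and q = y, OF wf con pos]
    by (auto simp: path_dist_def intro!: cInf_greatest dest: path_length_in_points[OF _ wf])
  show "path_dist G l x y = path_dist G l y x"
    using path_length_sym wf by (auto simp: path_dist_def intro!: arg_cong[where f = Inf])
  assume x: "x \<in> points G l" and y: "y \<in> points G l"
  show "path_dist G l x y = 0 \<longleftrightarrow> x = y"
  proof
    assume "x = y"
    then have "path_dist G l x y \<le> 0"
      using path_dist_le[OF wf path_length.refl] x by blast
    with \<open>0 \<le> path_dist G l x y\<close> show "path_dist G l x y = 0" by simp
  qed (use path_dist_pos[OF fin con pos x y] in blast)
  assume z: "z \<in> points G l"
  have le: "path_dist G l x z - L \<le> L'"
    if "path_length G l x y L" "path_length G l y z L'" for L L'
    using path_dist_le[OF wf path_length_trans[OF that(2,1)]] by simp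
  have "path_dist G l x z - L \<le> path_dist G l y z" if "path_length G l x y L" for L
    unfolding path_dist_def[of G l y z] using y z ex_path_length[OF wf con pos y z] le[OF that]
    by (auto intro!: cInf_greatest)
  then have "path_dist G l x z - path_dist G l y z \<le> L" if "path_length G l x y L" for L
    using that by fastforce
  then have "path_dist G l x z - path_dist G l y z \<le> path_dist G l x y"
    unfolding path_dist_def[of G l x y] using x y ex_path_length[OF wf con pos x y]
    by (auto intro!: cInf_greatest)
  then show "path_dist G l x z \<le> path_dist G l x y + path_dist G l y z" by simp
qed

definition metric_graph_topology ::
  "('a, 'b) pre_digraph \<Rightarrow> ('b \<Rightarrow> real) \<Rightarrow> ('a, 'b) mpoint topology" where
  "metric_graph_topology G l = Metric_space.mtopology (points G l) (path_dist G l)"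

definition piecewise_linear_int_slopes :: "real \<Rightarrow> (real \<Rightarrow> real) \<Rightarrow> bool" where
  "piecewise_linear_int_slopes c g \<longleftrightarrow>
     (\<exists>(n :: nat) (\<tau> :: nat \<Rightarrow> real). \<tau> 0 = 0 \<and> \<tau> n = c \<and>
        (\<forall>i<n. \<tau> i < \<tau> (Suc i) \<and>
           (\<exists>m :: int. \<forall>t \<in> {\<tau> i..\<tau> (Suc i)}. g t = g (\<tau> i) + of_int m * (t - \<tau> i))))"

definition rational_function ::
  "('a, 'b) pre_digraph \<Rightarrow> ('b \<Rightarrow> real) \<Rightarrow> (('a, 'b) mpoint \<Rightarrow> real) \<Rightarrow> bool" where
  "rational_function G l f \<longleftrightarrow>
     continuous_map (metric_graph_topology G l) euclideanreal f \<and>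
     (\<forall>e \<in> arcs G. piecewise_linear_int_slopes (l e) (\<lambda>t. f (edge_point G l e t)))"

text \<open>
  A direction emanating from \<open>p\<close> is a triple \<open>(e, t, s)\<close>: \<open>p\<close> lies at position \<open>t\<close> of the edge \<open>e\<close>,
  and one moves along \<open>e\<close> towards its head (\<open>s = 1\<close>) or towards its tail (\<open>s = -1\<close>).
\<close>

definition directions ::
  "('a, 'b) pre_digraph \<Rightarrow> ('b \<Rightarrow> real) \<Rightarrow> ('a, 'b) mpoint \<Rightarrow> ('b \<times> real \<times> real) set" where
  "directions G l p =
     {(e, t, s). e \<in> arcs G \<and> t \<in> {0..l e} \<and> edge_point G l e t = p \<and>
        (s = 1 \<and> t < l e \<or> s = -1 \<and> 0 < t)}"

definition outgoing_slope ::
  "('a, 'b) pre_digraph \<Rightarrow> ('b \<Rightarrow> real) \<Rightarrow> (('a, 'b) mpoint \<Rightarrow> real) \<Rightarrow> 'b \<times> real \<times> real \<Rightarrow> real" where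
  "outgoing_slope G l f = (\<lambda>(e, t, s).
     Lim (at_right 0) (\<lambda>h. (f (edge_point G l e (t + s * h)) - f (edge_point G l e t)) / h))"

definition metric_principal_divisors ::
  "('a, 'b) pre_digraph \<Rightarrow> ('b \<Rightarrow> real) \<Rightarrow> ('a, 'b) mpoint divisor set" where
  "metric_principal_divisors G l =
     {D \<in> divisors (points G l).
        \<exists>f. rational_function G l f \<and>
          (\<forall>p \<in> points G l.
             of_int (Poly_Mapping.lookup D p) = (\<Sum>d\<in>directions G l p. outgoing_slope G l f d))}"

definition metric_dgon :: "('a, 'b) pre_digraph \<Rightarrow> ('b \<Rightarrow> real) \<Rightarrow> int \<Rightarrow> int" where
  "metric_dgon G l r = dgon (points G l) (metric_principal_divisors G l) r"

end

theory Submission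
  imports Defs
begin

text \<open>
  Removing a chip lowers the rank by at most one, so a divisor of minimal degree among those of rank
  at least \<open>r\<close> has rank exactly \<open>r\<close>, and only the property of having rank at least \<open>r\<close> matters.
  For a divisor on \<open>\<sigma>\<^sub>k(G)\<close>, this property is the same on \<open>\<sigma>\<^sub>k(G)\<close> and on \<open>\<Gamma>(G)\<close>: integer-valued
  functions on \<open>\<sigma>\<^sub>k(G)\<close> extend to \<open>\<Gamma>(G)\<close> by linear interpolation, rational functions on \<open>\<Gamma>(G)\<close>
  restrict to \<open>\<sigma>\<^sub>k(G)\<close> by rounding down, and it suffices to test the rank with effective divisors
  supported on the vertices of any loopless model.

  Conversely, that a divisor \<open>D\<close> on \<open>\<Gamma>(G)\<close> has rank at least \<open>r\<close> is witnessed by finitely many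
  rational functions, one for each effective divisor of degree \<open>r\<close> on \<open>V(G)\<close>. Their breakpoints,
  their values there and the support of \<open>D\<close> satisfy finitely many linear equations with integer
  coefficients. By Dirichlet's theorem on simultaneous approximation there is a \<open>k\<close> for which \<open>k\<close>
  times each of these numbers is so close to an integer that rounding preserves all the equations;
  this moves \<open>D\<close> to a divisor on \<open>\<sigma>\<^sub>k(G)\<close> of the same degree and of rank at least \<open>r\<close>.
\<close>


subsection \<open>Divisors and rank\<close>

text \<open>The breakpoints and values of the witnesses may be irrational, so no subdivision need
  contain them, and approximating each number separately would destroy the equations (difference of
  values) = slope * (difference of positions) that tie them together. With one multiplier
  \<open>k\<close> for all numbers, positions and values are rounded on the same scale, while the
  slopes, being integers, are kept. The defect of a rounded equation is then an integer, and it is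
  made of a few rounding errors, some of them multiplied by a slope. Once the errors are small
  compared with the reciprocal of the largest slope, the defect is below 1 in absolute value, hence
  zero. Keeping the slopes also keeps the slope sums at the breakpoints, so effectivity is not
  endangered. The bound on the slopes has to be known before \<open>k\<close> is chosen. Hence the
  test divisors may not depend on \<open>k\<close>, which is why the rank is tested on V(G) and not
  on the vertices of the subdivision. Unit lengths enter through the ends of the edges: 0 and 1 are
  rounded to 0 and \<open>k\<close> without error, so all rounded edges again have the same
  length.\<close>

abbreviation chip :: "'p \<Rightarrow> 'p divisor" where
  "chip p \<equiv> Poly_Mapping.single p 1"

lemma div_degree_eq_sum:
  assumes "finite A" "Poly_Mapping.keys D \<subseteq> A"
  shows "div_degree D = (\<Sum>p\<in>A. Poly_Mapping.lookup D p)"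
  unfolding div_degree_def using assms
  by (intro sum.mono_neutral_left) (auto simp: in_keys_iff)

lemma div_degree_0 [simp]: "div_degree 0 = 0"
  by (simp add: div_degree_def)

lemma div_degree_add: "div_degree (D + D') = div_degree D + div_degree D'"
proof -
  let ?A = "Poly_Mapping.keys D \<union> Poly_Mapping.keys D'"
  have "Poly_Mapping.keys (D + D') \<subseteq> ?A" by (rule Poly_Mapping.keys_add)
  then show ?thesis
    by (simp add: div_degree_eq_sum[of ?A] lookup_add sum.distrib)
qed

lemma div_degree_uminus: "div_degree (- D) = - div_degree D"
  by (simp add: div_degree_def sum_negf)

lemma div_degree_diff: "div_degree (D - D') = div_degree D - div_degree D'"
  using div_degree_add[of D "- D'"] by (simp add: div_degree_uminus)

lemma div_degree_single [simp]: "div_degree (Poly_Mapping.single p n) = n"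
  by (simp add: div_degree_def)

lemma divisors_add: "D \<in> divisors P \<Longrightarrow> D' \<in> divisors P \<Longrightarrow> D + D' \<in> divisors P"
  using Poly_Mapping.keys_add[of D D'] by (auto simp: divisors_def)

lemma divisors_diff: "D \<in> divisors P \<Longrightarrow> D' \<in> divisors P \<Longrightarrow> D - D' \<in> divisors P"
  using Poly_Mapping.keys_diff[of D D'] by (auto simp: divisors_def)

lemma divisors_single: "p \<in> P \<Longrightarrow> Poly_Mapping.single p n \<in> divisors P"
  by (auto simp: divisors_def)

lemma divisors_0 [simp]: "0 \<in> divisors P"
  by (simp add: divisors_def)

lemma divisors_lookup_eq_0: "D \<in> divisors P \<Longrightarrow> p \<notin> P \<Longrightarrow> Poly_Mapping.lookup D p = 0"
  by (auto simp: divisors_def in_keys_iff)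

lemma divisorsI: "(\<And>p. p \<notin> P \<Longrightarrow> Poly_Mapping.lookup D p = 0) \<Longrightarrow> D \<in> divisors P"
  by (auto simp: divisors_def in_keys_iff)

lemma div_degree_nonneg: "effective D \<Longrightarrow> 0 \<le> div_degree D"
  by (auto simp: div_degree_def effective_def intro: sum_nonneg)

lemma effective_add: "effective D \<Longrightarrow> effective D' \<Longrightarrow> effective (D + D')"
  by (auto simp: effective_def lookup_add)

lemma effective_single: "0 \<le> n \<Longrightarrow> effective (Poly_Mapping.single p n)"
  by (auto simp: effective_def lookup_single when_def)

lemma effective_degree_0:
  assumes "effective D" "div_degree D = 0" shows "D = 0"
proof (rule poly_mapping_eqI)
  fix p
  show "Poly_Mapping.lookup D p = Poly_Mapping.lookup 0 p"
    using assms sum_nonneg_eq_0_iff[of "Poly_Mapping.keys D" "Poly_Mapping.lookup D"]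
    by (cases "p \<in> Poly_Mapping.keys D") (auto simp: div_degree_def effective_def in_keys_iff)
qed

lemma lookup_le_degree:
  assumes "effective D" shows "Poly_Mapping.lookup D p \<le> div_degree D"
proof (cases "p \<in> Poly_Mapping.keys D")
  case True
  then show ?thesis
    using assms member_le_sum[of p "Poly_Mapping.keys D" "Poly_Mapping.lookup D"]
    by (auto simp: div_degree_def effective_def)
next
  case False
  then show ?thesis using div_degree_nonneg[OF assms] by (simp add: in_keys_iff)
qed

lemma effective_degree_SucE:
  assumes "effective D" "div_degree D = int (Suc n)" "D \<in> divisors P"
  obtains p D' where "p \<in> P" "D = chip p + D'" "effective D'" "div_degree D' = int n"
      "D' \<in> divisors P"
proof -
  have "Poly_Mapping.keys D \<noteq> {}" using assms(2) by (auto simp: div_degree_def)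
  then obtain p where p: "p \<in> Poly_Mapping.keys D" by blast
  then have "p \<in> P" using assms(3) by (auto simp: divisors_def)
  moreover have "effective (D - chip p)"
    using assms(1) p by (auto simp: effective_def lookup_minus lookup_single when_def in_keys_iff)
      (metis int_one_le_iff_zero_less order_le_less)
  moreover have "div_degree (D - chip p) = int n" using assms(2) by (simp add: div_degree_diff)
  moreover have "D - chip p \<in> divisors P"
    using assms(3) \<open>p \<in> P\<close> by (intro divisors_diff divisors_single)
  ultimately show thesis using that[of p "D - chip p"] by simp
qed

text \<open>Ensures that only finitely many witnesses have to be rounded at once. All coefficients
  lie between 0 and the degree.\<close>

lemma finite_effective_divisors:
  assumes "finite A" shows "finite {E \<in> divisors A. effective E \<and> div_degree E = r}"
proof -
  let ?F = "{g. \<forall>x. (x \<in> A \<longrightarrow> g x \<in> {0..r}) \<and> (x \<notin> A \<longrightarrow> g x = 0)}"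
  have "finite ?F" by (rule finite_set_of_finite_funs) (use assms in auto)
  moreover have "Poly_Mapping.lookup ` {E \<in> divisors A. effective E \<and> div_degree E = r} \<subseteq> ?F"
    by (auto simp: divisors_lookup_eq_0 lookup_le_degree) (auto simp: effective_def)
  ultimately have "finite (Poly_Mapping.lookup ` {E \<in> divisors A. effective E \<and> div_degree E = r})"
    by (rule finite_subset[rotated])
  then show ?thesis by (rule finite_imageD) (auto simp: inj_on_def intro: poly_mapping_eqI)
qed

section \<open>Push-forward of divisors along a map of points\<close>

definition push_divisor :: "('p \<Rightarrow> 'q) \<Rightarrow> 'p divisor \<Rightarrow> 'q divisor" where
  "push_divisor \<phi> D = (\<Sum>p\<in>Poly_Mapping.keys D. Poly_Mapping.single (\<phi> p) (Poly_Mapping.lookup D p))"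

lemma lookup_push_divisor:
  "Poly_Mapping.lookup (push_divisor \<phi> D) q =
     (\<Sum>p | p \<in> Poly_Mapping.keys D \<and> \<phi> p = q. Poly_Mapping.lookup D p)"
  unfolding push_divisor_def lookup_sum lookup_single when_def
  by (rule sum.inter_filter[symmetric]) simp

lemma push_divisor_diff: "push_divisor \<phi> (D - E) = push_divisor \<phi> D - push_divisor \<phi> E"
proof -
  define A where "A = Poly_Mapping.keys D \<union> Poly_Mapping.keys E"
  have *: "push_divisor \<phi> F = (\<Sum>p\<in>A. Poly_Mapping.single (\<phi> p) (Poly_Mapping.lookup F p))"
    if "Poly_Mapping.keys F \<subseteq> A" for F
    unfolding push_divisor_def using that
    by (intro sum.mono_neutral_left) (auto simp: A_def in_keys_iff)
  have "Poly_Mapping.keys (D - E) \<subseteq> A" unfolding A_def by (rule Poly_Mapping.keys_diff)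
  then show ?thesis
    by (simp add: * A_def[symmetric] lookup_minus single_diff sum_subtractf)
      (simp add: * A_def)
qed

lemma lookup_push_divisor_inj:
  assumes "inj_on \<phi> A" "Poly_Mapping.keys D \<subseteq> A" "p \<in> A"
  shows "Poly_Mapping.lookup (push_divisor \<phi> D) (\<phi> p) = Poly_Mapping.lookup D p"
proof -
  have "{p'. p' \<in> Poly_Mapping.keys D \<and> \<phi> p' = \<phi> p} = (if p \<in> Poly_Mapping.keys D then {p} else {})"
    using assms by (auto dest: inj_onD)
  then show ?thesis unfolding lookup_push_divisor by (simp add: in_keys_iff)
qed

lemma lookup_push_divisor_notin:
  assumes "q \<notin> \<phi> ` Poly_Mapping.keys D" shows "Poly_Mapping.lookup (push_divisor \<phi> D) q = 0"
proof -
  have "{p. p \<in> Poly_Mapping.keys D \<and> \<phi> p = q} = {}" using assms by auto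
  then show ?thesis unfolding lookup_push_divisor by (simp only: sum.empty)
qed

lemma push_divisor_in_divisors:
  assumes "D \<in> divisors P" "\<And>p. p \<in> P \<Longrightarrow> \<phi> p \<in> Q" shows "push_divisor \<phi> D \<in> divisors Q"
proof (rule divisorsI)
  fix q assume "q \<notin> Q"
  then have "q \<notin> \<phi> ` Poly_Mapping.keys D" using assms by (auto simp: divisors_def)
  then show "Poly_Mapping.lookup (push_divisor \<phi> D) q = 0" by (rule lookup_push_divisor_notin)
qed

lemma div_degree_push_divisor [simp]: "div_degree (push_divisor \<phi> D) = div_degree D"
proof -
  have "div_degree (\<Sum>p\<in>A. Poly_Mapping.single (\<phi> p) (h p)) = (\<Sum>p\<in>A. h p)" if "finite A" for A h
    using that by (induction A rule: finite_induct) (auto simp: div_degree_add)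
  from this[OF finite_keys] show ?thesis unfolding push_divisor_def by (simp add: div_degree_def)
qed

lemma effective_push_divisor: "effective D \<Longrightarrow> effective (push_divisor \<phi> D)"
  unfolding effective_def lookup_push_divisor by (auto intro: sum_nonneg)

section \<open>Winnability (a term from the dollar game) and lower bounds for the rank\<close>

definition winnable :: "'p set \<Rightarrow> 'p divisor set \<Rightarrow> 'p divisor \<Rightarrow> bool" where
  "winnable P Prin D \<longleftrightarrow> (\<exists>F \<in> divisors P. effective F \<and> equivalent Prin D F)"

text \<open>\<open>div_rank\<close> is a \<open>GREATEST\<close>, which says nothing before a
  maximum is known to exist. This predicate can be used at once; \<open>rank_ge_iff\<close> connects
  the two.\<close>

definition rank_ge :: "'p set \<Rightarrow> 'p divisor set \<Rightarrow> 'p divisor \<Rightarrow> int \<Rightarrow> bool" where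
  "rank_ge P Prin D k \<longleftrightarrow>
     (\<forall>E \<in> divisors P. effective E \<and> div_degree E = k \<longrightarrow> winnable P Prin (D - E))"

lemma div_rank_eq: "div_rank P Prin D = (GREATEST k. rank_ge P Prin D k)"
  unfolding div_rank_def rank_ge_def winnable_def ..

lemma winnable_add:
  assumes "winnable P Prin D" "effective F" "F \<in> divisors P"
  shows "winnable P Prin (D + F)"
proof -
  obtain F0 where "F0 \<in> divisors P" "effective F0" "D - F0 \<in> Prin"
    using assms(1) by (auto simp: winnable_def equivalent_def)
  then show ?thesis
    using assms(2,3) unfolding winnable_def equivalent_def
    by (intro bexI[of _ "F0 + F"] conjI effective_add divisors_add) auto
qed

text \<open>A criterion for \<open>A\<close> to be rank-determining. A condition on a single chip
  suffices because it is required for every divisor: the chips of \<open>E\<close> are exchanged one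
  at a time, while the others are absorbed into \<open>D\<close>.\<close>

lemma rank_ge_of_subset:
  assumes "A \<subseteq> P" "D \<in> divisors P"
    and step: "\<And>D p. D \<in> divisors P \<Longrightarrow> p \<in> P \<Longrightarrow> (\<And>a. a \<in> A \<Longrightarrow> winnable P Prin (D - chip a)) \<Longrightarrow>
      winnable P Prin (D - chip p)"
    and A: "\<And>E. E \<in> divisors A \<Longrightarrow> effective E \<Longrightarrow> div_degree E = k \<Longrightarrow> winnable P Prin (D - E)"
  shows "rank_ge P Prin D k"
proof -
  have *: "winnable P Prin (D - E)"
    if "D \<in> divisors P" "E \<in> divisors P" "effective E" "div_degree E = int n"
      "\<And>E. E \<in> divisors A \<Longrightarrow> effective E \<Longrightarrow> div_degree E = int n \<Longrightarrow> winnable P Prin (D - E)"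
    for n D E
    using that
  proof (induction n arbitrary: D E)
    case 0
    then have "E = 0" using effective_degree_0 by auto
    then show ?case using 0(5)[of 0] by (simp add: effective_def)
  next
    case (Suc n)
    obtain p E' where E': "p \<in> P" "E = chip p + E'" "effective E'" "div_degree E' = int n"
        "E' \<in> divisors P"
      using effective_degree_SucE[OF Suc.prems(3,4,2)] by metis
    \<comment> \<open>The other \<open>n\<close> chips still lie in \<open>A\<close>, so
      \<open>step\<close> for \<open>D - E''\<close> trades only the chip at \<open>p\<close>. The
      induction hypothesis for \<open>D - chip p\<close> then frees the others.\<close>
    have "winnable P Prin (D - chip p - E'')"
      if E'': "E'' \<in> divisors A" "effective E''" "div_degree E'' = int n" for E''
    proof -
      have "E'' \<in> divisors P" using E'' assms(1) by (auto simp: divisors_def)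
      moreover have "winnable P Prin (D - E'' - chip a)" if "a \<in> A" for a
        using Suc.prems(5)[of "chip a + E''"] E'' that
        by (simp add: divisors_add divisors_single effective_add effective_single div_degree_add
            diff_diff_add add.commute)
      ultimately have "winnable P Prin (D - E'' - chip p)"
        using step Suc.prems(1) E'(1) by (meson divisors_diff)
      then show ?thesis by (simp add: diff_diff_add add.commute)
    qed
    then have "winnable P Prin (D - chip p - E')"
      using Suc.IH[of "D - chip p" E'] E' Suc.prems(1) by (simp add: divisors_diff divisors_single)
    then show ?case using E'(2) by (simp add: diff_diff_add)
  qed
  show ?thesis
    unfolding rank_ge_def
  proof (intro ballI impI)
    fix E assume E: "E \<in> divisors P" "effective E \<and> div_degree E = k"
    then have "k = int (nat k)" using div_degree_nonneg by auto
    then show "winnable P Prin (D - E)" using *[of D E "nat k"] E assms(2) A by simp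
  qed
qed

text \<open>These two properties bound the rank by the degree, so that the \<open>GREATEST\<close>
  and \<open>LEAST\<close> in the definitions are attained.\<close>

locale divisor_theory =
  fixes P :: "'p set" and Prin :: "'p divisor set"
  assumes nonempty: "P \<noteq> {}"
    and degree_Prin: "D \<in> Prin \<Longrightarrow> div_degree D = 0"
begin

lemma winnable_degree: "winnable P Prin D \<Longrightarrow> 0 \<le> div_degree D"
  using degree_Prin div_degree_nonneg
  by (fastforce simp: winnable_def equivalent_def div_degree_diff)

text \<open>Pad the test divisor with \<open>k - k'\<close> chips at any one point, win, and give
  these chips back.\<close>

lemma rank_ge_mono:
  assumes "rank_ge P Prin D k" "k' \<le> k" shows "rank_ge P Prin D k'"
  unfolding rank_ge_def
proof (intro ballI impI)
  fix E assume E: "E \<in> divisors P" "effective E \<and> div_degree E = k'"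
  obtain p where p: "p \<in> P" using nonempty by blast
  define F where "F = Poly_Mapping.single p (k - k')"
  have F: "F \<in> divisors P" "effective F" "div_degree F = k - k'"
    using assms p by (auto simp: F_def effective_single divisors_single)
  have "winnable P Prin (D - (E + F))"
    using assms E F unfolding rank_ge_def by (auto simp: div_degree_add effective_add divisors_add)
  from winnable_add[OF this F(2,1)] show "winnable P Prin (D - E)" by simp
qed

lemma rank_ge_degree:
  assumes "rank_ge P Prin D k" "0 \<le> k" shows "k \<le> div_degree D"
proof -
  obtain p where "p \<in> P" using nonempty by blast
  then have "winnable P Prin (D - Poly_Mapping.single p k)"
    using assms unfolding rank_ge_def by (simp add: effective_single divisors_single)
  then show ?thesis using winnable_degree by (fastforce simp: div_degree_diff)
qed

lemma rank_ge_diff_chip: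
  assumes "rank_ge P Prin D k" "p \<in> P" shows "rank_ge P Prin (D - chip p) (k - 1)"
  unfolding rank_ge_def
proof (intro ballI impI)
  fix E assume E: "E \<in> divisors P" "effective E \<and> div_degree E = k - 1"
  then have "winnable P Prin (D - (chip p + E))"
    using assms unfolding rank_ge_def
    by (auto simp: div_degree_add effective_add divisors_add effective_single divisors_single)
  then show "winnable P Prin (D - chip p - E)" by (simp add: diff_diff_add)
qed

text \<open>The admissible \<open>k\<close> are unbounded below. Cutting them off at -1, where the
  condition is vacuous, leaves a finite nonempty set whose maximum is the rank.\<close>

lemma rank_ge_iff: "rank_ge P Prin D k \<longleftrightarrow> k \<le> div_rank P Prin D"
proof -
  define m where "m = nat (div_degree D + 1)"
  have vac: "rank_ge P Prin D (-1)"
    using div_degree_nonneg by (fastforce simp: rank_ge_def)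
  have bound: "k \<le> int m" if "rank_ge P Prin D k" for k
    using rank_ge_degree[OF that] by (cases "0 \<le> k") (auto simp: m_def)
  define S where "S = {k. -1 \<le> k \<and> rank_ge P Prin D k}"
  have "S \<subseteq> {-1..int m}" using bound by (auto simp: S_def)
  then have fin: "finite S" using finite_subset by blast
  have "S \<noteq> {}" using vac by (auto simp: S_def)
  have max: "rank_ge P Prin D (Max S)" using Max_in[OF fin \<open>S \<noteq> {}\<close>] by (simp add: S_def)
  have "div_rank P Prin D = Max S"
    unfolding div_rank_eq
  proof (rule Greatest_equality)
    fix k assume k: "rank_ge P Prin D k"
    show "k \<le> Max S"
    proof (cases "-1 \<le> k")
      case True
      then show ?thesis using k fin by (auto simp: S_def)
    next
      case False
      moreover have "-1 \<le> Max S" using Max_in[OF fin \<open>S \<noteq> {}\<close>] by (simp add: S_def)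
      ultimately show ?thesis by simp
    qed
  qed (rule max)
  moreover have "k \<le> Max S" if "rank_ge P Prin D k"
    using that Max_ge[OF fin, of k] Max_ge[OF fin, of "-1"] vac
        by (cases "-1 \<le> k") (auto simp: S_def)
  ultimately show ?thesis
    using rank_ge_mono[OF max] by auto
qed

lemma dgon_least:
  assumes "0 \<le> r" "D0 \<in> divisors P" "rank_ge P Prin D0 r"
  shows "\<exists>D \<in> divisors P. rank_ge P Prin D r \<and> div_degree D = dgon P Prin r"
    and "\<And>D. D \<in> divisors P \<Longrightarrow> rank_ge P Prin D r \<Longrightarrow> dgon P Prin r \<le> div_degree D"
proof -
  \<comment> \<open>A divisor of rank at least \<open>r\<close> has degree at least
    \<open>r\<close>, hence a natural number as degree; this is what makes a least degree
    exist.\<close>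
  define A where "A n \<longleftrightarrow> (\<exists>D \<in> divisors P. rank_ge P Prin D r \<and> div_degree D = int n)" for n
  have degA: "\<exists>n. div_degree D = int n" if "rank_ge P Prin D r" for D
    using rank_ge_degree[OF that assms(1)] assms(1) by (metis nonneg_int_cases order_trans)
  define n where "n = (LEAST n. A n)"
  have "A n" unfolding n_def using assms degA by (metis A_def LeastI)
  then obtain D where D: "D \<in> divisors P" "rank_ge P Prin D r" "div_degree D = int n"
    by (auto simp: A_def)
  have least: "int n \<le> div_degree D'" if D': "D' \<in> divisors P" "rank_ge P Prin D' r" for D'
  proof -
    obtain m where "div_degree D' = int m" using degA[OF D'(2)] by blast
    moreover from this have "A m" using D' by (auto simp: A_def)
    ultimately show ?thesis using Least_le[of A m] by (simp add: n_def)
  qed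
  have "div_rank P Prin D = r"
  proof (rule ccontr)
    assume "div_rank P Prin D \<noteq> r"
    then have "rank_ge P Prin D (r + 1)" using D(2) by (simp add: rank_ge_iff)
    moreover obtain p where "p \<in> P" using nonempty by blast
    ultimately have "rank_ge P Prin (D - chip p) r" using rank_ge_diff_chip by fastforce
    moreover have "D - chip p \<in> divisors P"
      using D \<open>p \<in> P\<close> by (intro divisors_diff divisors_single)
    ultimately show False using least[of "D - chip p"] D(3) by (simp add: div_degree_diff)
  qed
  then have "dgon P Prin r = int n"
    unfolding dgon_def using D least by (intro Least_equality) (auto simp: rank_ge_iff)
  then show "\<exists>D \<in> divisors P. rank_ge P Prin D r \<and> div_degree D = dgon P Prin r"
    and "\<And>D. D \<in> divisors P \<Longrightarrow> rank_ge P Prin D r \<Longrightarrow> dgon P Prin r \<le> div_degree D"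
    using D least by auto
qed

end


subsection \<open>Piecewise linear functions on an interval\<close>

text \<open>Compactness of an interval in the form of an induction, for passing from germs to the
  whole interval. The supremum of the initial segments on which \<open>P\<close> holds inherits
  \<open>P\<close> by \<open>limit\<close> and cannot stay below \<open>c\<close> by
  \<open>step\<close>.\<close>

lemma real_induction [consumes 1, case_names zero step limit]:
  fixes c :: real
  assumes "0 \<le> c" and zero: "P 0"
    and step: "\<And>x. 0 \<le> x \<Longrightarrow> x < c \<Longrightarrow> P x \<Longrightarrow> \<exists>y>x. y \<le> c \<and> (\<forall>z. x < z \<and> z \<le> y \<longrightarrow> P z)"
    and limit: "\<And>x. 0 < x \<Longrightarrow> x \<le> c \<Longrightarrow> (\<And>z. 0 \<le> z \<Longrightarrow> z < x \<Longrightarrow> P z) \<Longrightarrow> P x"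
  shows "P c"
proof -
  define A where "A = {x. 0 \<le> x \<and> x \<le> c \<and> (\<forall>z. 0 \<le> z \<and> z \<le> x \<longrightarrow> P z)}"
  define s where "s = Sup A"
  have zA: "0 \<in> A" using assms(1) zero by (auto simp: A_def)
  have bdd: "bdd_above A" by (auto simp: A_def intro!: bdd_aboveI[of _ c])
  have "0 \<le> s" unfolding s_def by (rule cSup_upper[OF zA bdd])
  have "s \<le> c" unfolding s_def using zA by (intro cSup_least) (blast, simp add: A_def)
  have below: "P z" if "0 \<le> z" "z < s" for z
  proof -
    obtain x where "x \<in> A" "z < x" using less_cSupE[of z A] \<open>z < s\<close> zA s_def by blast
    then show ?thesis using \<open>0 \<le> z\<close> by (auto simp: A_def)
  qed
  then have "P s" using limit[of s] zero \<open>0 \<le> s\<close> \<open>s \<le> c\<close> by (cases "s = 0") auto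
  moreover have False if "s < c"
  proof -
    obtain y where y: "y > s" "y \<le> c" "\<And>z. s < z \<Longrightarrow> z \<le> y \<Longrightarrow> P z"
      using step[of s] \<open>0 \<le> s\<close> \<open>s < c\<close> \<open>P s\<close> by blast
    have "P z" if "0 \<le> z" "z \<le> y" for z
      using below[of z] \<open>P s\<close> y(3)[of z] that by (cases z s rule: linorder_cases) auto
    then have "y \<in> A" using y \<open>0 \<le> s\<close> by (auto simp: A_def)
    then have "y \<le> s" unfolding s_def by (intro cSup_upper bdd)
    then show False using y by simp
  qed
  ultimately show ?thesis using \<open>s \<le> c\<close> by (cases "s = c") auto
qed

lemma piecewise_linear_induct [consumes 1, case_names zero extend]:
  assumes "piecewise_linear_int_slopes c g" and "P 0"
    and extend: "\<And>a b m. 0 \<le> a \<Longrightarrow> a < b \<Longrightarrow> b \<le> c \<Longrightarrow> P a \<Longrightarrow>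
      \<forall>t\<in>{a..b}. g t = g a + of_int m * (t - a) \<Longrightarrow> P b"
  shows "P c"
proof -
  obtain n and \<tau> :: "nat \<Rightarrow> real" where \<tau>: "\<tau> 0 = 0" "\<tau> n = c" "\<And>i. i < n \<Longrightarrow> \<tau> i < \<tau> (Suc i)"
    and lin: "\<And>i. i < n \<Longrightarrow> \<exists>m :: int. \<forall>t\<in>{\<tau> i..\<tau> (Suc i)}. g t = g (\<tau> i) + of_int m * (t - \<tau> i)"
    using assms(1) unfolding piecewise_linear_int_slopes_def by blast
  have mono: "\<tau> i \<le> \<tau> j" if "i \<le> j" "j \<le> n" for i j
    using that
  proof (induction j rule: dec_induct)
    case (step j)
    then show ?case using \<tau>(3)[of j] by simp
  qed simp
  have "P (\<tau> i)" if "i \<le> n" for i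
    using that
  proof (induction i)
    case 0
    then show ?case using \<tau> assms(2) by simp
  next
    case (Suc i)
    then obtain m :: int where "\<forall>t\<in>{\<tau> i..\<tau> (Suc i)}. g t = g (\<tau> i) + of_int m * (t - \<tau> i)"
      using lin[of i] by auto
    moreover have "0 \<le> \<tau> i" "\<tau> i < \<tau> (Suc i)" "\<tau> (Suc i) \<le> c" "P (\<tau> i)"
      using Suc \<tau>(3)[of i] mono[of 0 i] mono[of "Suc i" n] \<tau>(1,2) by simp_all
    ultimately show ?case using extend by blast
  qed
  then show ?thesis using \<tau>(2) by auto
qed

lemma piecewise_linear_zero: "piecewise_linear_int_slopes 0 g"
  unfolding piecewise_linear_int_slopes_def by (intro exI[of _ "0::nat"]) auto

lemma piecewise_linear_extend:
  assumes "piecewise_linear_int_slopes a g" "a < b"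
    and lin: "\<And>t. a \<le> t \<Longrightarrow> t \<le> b \<Longrightarrow> g t = g a + of_int (m :: int) * (t - a)"
  shows "piecewise_linear_int_slopes b g"
proof -
  obtain n and \<tau> :: "nat \<Rightarrow> real" where \<tau>: "\<tau> 0 = 0" "\<tau> n = a"
    and pieces: "\<And>i. i < n \<Longrightarrow> \<tau> i < \<tau> (Suc i) \<and>
      (\<exists>m :: int. \<forall>t\<in>{\<tau> i..\<tau> (Suc i)}. g t = g (\<tau> i) + of_int m * (t - \<tau> i))"
    using assms(1) unfolding piecewise_linear_int_slopes_def by blast
  define \<tau>' where "\<tau>' = \<tau>(Suc n := b)"
  show ?thesis
    unfolding piecewise_linear_int_slopes_def
  proof (intro exI[of _ "Suc n"] exI[of _ \<tau>'] conjI allI impI)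
    fix i assume "i < Suc n"
    then consider "i < n" | "i = n" by linarith
    then have "\<tau>' i < \<tau>' (Suc i) \<and>
      (\<exists>m :: int. \<forall>t\<in>{\<tau>' i..\<tau>' (Suc i)}. g t = g (\<tau>' i) + of_int m * (t - \<tau>' i))"
    proof cases
      case 1
      then show ?thesis using pieces[of i] by (auto simp: \<tau>'_def)
    next
      case 2
      then have "\<tau>' i = a" "\<tau>' (Suc i) = b" using \<tau> by (simp_all add: \<tau>'_def)
      then show ?thesis using assms(2) lin by (metis atLeastAtMost_iff)
    qed
    then show "\<tau>' i < \<tau>' (Suc i)"
      "\<exists>m :: int. \<forall>t\<in>{\<tau>' i..\<tau>' (Suc i)}. g t = g (\<tau>' i) + of_int m * (t - \<tau>' i)" by auto
  qed (use \<tau> in \<open>auto simp: \<tau>'_def\<close>)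
qed

section \<open>One-sided slopes and the local form of piecewise linearity\<close>

text \<open>
  The slope \<open>m\<close> is measured in the direction \<open>s = 1\<close> or \<open>s = -1\<close> leading away from \<open>t\<close>, so
  that a linear function has opposite slopes in its two directions.
\<close>

definition germ :: "(real \<Rightarrow> real) \<Rightarrow> real \<Rightarrow> real \<Rightarrow> int \<Rightarrow> bool" where
  "germ g t s m \<longleftrightarrow> (\<forall>\<^sub>F h in at_right 0. g (t + s * h) = g t + of_int m * h)"

text \<open>Unlike a partition into linear pieces, this local condition passes to sums and maxima
  point by point, with no common refinement.\<close>

definition has_germs :: "real \<Rightarrow> (real \<Rightarrow> real) \<Rightarrow> bool" where
  "has_germs c g \<longleftrightarrow> (\<forall>t. 0 \<le> t \<and> t < c \<longrightarrow> (\<exists>m. germ g t 1 m)) \<and>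
     (\<forall>t. 0 < t \<and> t \<le> c \<longrightarrow> (\<exists>m. germ g t (-1) m))"

lemma germE:
  assumes "germ g t s m" "0 < d"
  obtains \<epsilon> where "0 < \<epsilon>" "\<epsilon> \<le> d" "\<And>h. 0 \<le> h \<Longrightarrow> h \<le> \<epsilon> \<Longrightarrow> g (t + s * h) = g t + of_int m * h"
proof -
  obtain b where b: "b > 0" "\<And>h. 0 < h \<Longrightarrow> h < b \<Longrightarrow> g (t + s * h) = g t + of_int m * h"
    using assms(1) unfolding germ_def eventually_at_right_field by auto
  show thesis
    by (rule that[of "min d (b / 2)"]) (use assms(2) b in \<open>auto simp: order_le_less\<close>)
qed

lemma germI:
  assumes "0 < \<epsilon>" "\<And>h. 0 < h \<Longrightarrow> h < \<epsilon> \<Longrightarrow> g (t + s * h) = g t + of_int m * h"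
  shows "germ g t s m"
  unfolding germ_def eventually_at_right_field using assms by auto

lemma germ_unique: "germ g t s m \<Longrightarrow> germ g t s m' \<Longrightarrow> m = m'"
proof -
  assume "germ g t s m" "germ g t s m'"
  then have "\<forall>\<^sub>F h in at_right (0 :: real). m = m'"
    unfolding germ_def using eventually_at_right_less[of "0 :: real"]
    by eventually_elim auto
  then show ?thesis by simp
qed

lemma germ_add:
  assumes "germ f t s m" "germ g t s n" shows "germ (\<lambda>x. f x + g x) t s (m + n)"
  using assms unfolding germ_def by eventually_elim (simp add: algebra_simps)

lemma germ_uminus:
  assumes "germ f t s m" shows "germ (\<lambda>x. - f x) t s (- m)"
  using assms unfolding germ_def by eventually_elim simp

lemma germ_const: "germ (\<lambda>x. a) t s 0"
  by (simp add: germ_def)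

lemma germ_max_const:
  assumes "germ f t s m"
  shows "germ (\<lambda>x. max (f x) a) t s (if f t > a then m else if f t = a then max m 0 else 0)"
proof -
  have "((\<lambda>h. f t + of_int m * h) \<longlongrightarrow> f t + of_int m * 0) (at_right 0)"
    by (intro tendsto_intros)
  then have lim: "((\<lambda>h. f t + of_int m * h) \<longlongrightarrow> f t) (at_right 0)" by simp
  consider "f t > a" | "f t = a" | "f t < a" by linarith
  then show ?thesis
  proof cases
    case 1
    then show ?thesis
      using eventually_conj[OF assms[unfolded germ_def] order_tendstoD(1)[OF lim 1]]
      unfolding germ_def by (auto elim: eventually_mono)
  next
    case 2
    then show ?thesis
      using eventually_conj[OF assms[unfolded germ_def] eventually_at_right_less[of "0 :: real"]]
      unfolding germ_def
      by (auto elim!: eventually_mono simp: max_def zero_le_mult_iff mult_le_0_iff)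
  next
    case 3
    then show ?thesis
      using eventually_conj[OF assms[unfolded germ_def] order_tendstoD(2)[OF lim 3]]
      unfolding germ_def by (auto elim: eventually_mono)
  qed
qed

lemma germ_linear_right:
  assumes "\<And>t. a \<le> t \<Longrightarrow> t \<le> b \<Longrightarrow> g t = g a + of_int m * (t - a)" "a \<le> t" "t < b"
  shows "germ g t 1 m"
proof (rule germI[of "b - t"])
  fix h assume "0 < h" "h < b - t"
  then show "g (t + 1 * h) = g t + of_int m * h"
    using assms(1)[of t] assms(1)[of "t + h"] assms(2,3) by (simp add: algebra_simps)
qed (use assms(3) in simp)

lemma germ_linear_left:
  assumes "\<And>t. a \<le> t \<Longrightarrow> t \<le> b \<Longrightarrow> g t = g a + of_int m * (t - a)" "a < t" "t \<le> b"
  shows "germ g t (-1) (- m)"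
proof (rule germI[of "t - a"])
  fix h assume "0 < h" "h < t - a"
  then show "g (t + - 1 * h) = g t + of_int (- m) * h"
    using assms(1)[of t] assms(1)[of "t - h"] assms(2,3) by (simp add: algebra_simps)
qed (use assms(2) in simp)

text \<open>Backwards this is compactness: a right germ at \<open>x\<close> prolongs a finite
  partition of \<open>{0..x}\<close> beyond \<open>x\<close>, and a left germ at \<open>x\<close>
  joins \<open>x\<close> to a partition ending shortly before it.\<close>

lemma piecewise_linear_iff_has_germs:
  assumes "0 \<le> c"
  shows "piecewise_linear_int_slopes c g \<longleftrightarrow> has_germs c g"
proof
  assume "piecewise_linear_int_slopes c g"
  then show "has_germs c g"
  proof (induction rule: piecewise_linear_induct)
    case zero
    then show ?case by (auto simp: has_germs_def)
  next
    case (extend a b m)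
    have lin: "g t = g a + of_int m * (t - a)" if "a \<le> t" "t \<le> b" for t
      using extend.hyps(4) that by (meson atLeastAtMost_iff)
    show ?case
      unfolding has_germs_def
    proof (intro conjI allI impI)
      fix t assume "0 \<le> t \<and> t < b"
      then show "\<exists>m. germ g t 1 m"
        using extend.IH germ_linear_right[OF lin, of b t]
        unfolding has_germs_def by (cases "t < a") (blast, meson not_less order_refl)
    next
      fix t assume "0 < t \<and> t \<le> b"
      then show "\<exists>m. germ g t (-1) m"
        using extend.IH germ_linear_left[OF lin, of b t]
        unfolding has_germs_def by (cases "t \<le> a") (blast, meson not_le order_refl)
    qed
  qed
next
  assume germs: "has_germs c g"
  from assms show "piecewise_linear_int_slopes c g"
  proof (induction rule: real_induction)
    case zero
    then show ?case by (rule piecewise_linear_zero)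
  next
    case (step x)
    then obtain m where m: "germ g x 1 m" using germs by (auto simp: has_germs_def)
    obtain \<epsilon> where \<epsilon>: "0 < \<epsilon>" "\<epsilon> \<le> c - x" "\<And>h. 0 \<le> h \<Longrightarrow> h \<le> \<epsilon> \<Longrightarrow> g (x + 1 * h) = g x + of_int m * h"
      using germE[OF m, of "c - x"] step by auto
    have lin: "g t = g x + of_int m * (t - x)" if "x \<le> t" "t \<le> x + \<epsilon>" for t
      using \<epsilon>(3)[of "t - x"] that by simp
    have "piecewise_linear_int_slopes z g" if "x < z" "z \<le> x + \<epsilon>" for z
      by (rule piecewise_linear_extend[OF step(3) that(1) lin]) (use that in auto)
    then show ?case using \<epsilon> by (intro exI[of _ "x + \<epsilon>"]) auto
  next
    case (limit x)
    then obtain m where m: "germ g x (-1) m" using germs by (auto simp: has_germs_def)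
    obtain \<epsilon> where \<epsilon>: "0 < \<epsilon>" "\<epsilon> \<le> x" "\<And>h. 0 \<le> h \<Longrightarrow> h \<le> \<epsilon> \<Longrightarrow> g (x + (-1) * h) = g x + of_int m * h"
      using germE[OF m, of x] limit by auto
    have lin: "g t = g x + of_int m * (x - t)" if "x - \<epsilon> \<le> t" "t \<le> x" for t
      using \<epsilon>(3)[of "x - t"] that by simp
    have lin': "g t = g (x - \<epsilon>) + of_int (- m) * (t - (x - \<epsilon>))" if "x - \<epsilon> \<le> t" "t \<le> x" for t
      using lin[of t] lin[of "x - \<epsilon>"] \<epsilon>(1) that by (simp add: algebra_simps)
    have "piecewise_linear_int_slopes (x - \<epsilon>) g" using limit(3) \<epsilon>(1,2) by simp
    then show ?case
      by (rule piecewise_linear_extend[OF _ _ lin']) (use \<epsilon>(1) in simp_all)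
  qed
qed

lemma piecewise_linear_Lipschitz:
  assumes "piecewise_linear_int_slopes c g"
  shows "\<exists>M\<ge>0. \<forall>s\<in>{0..c}. \<forall>t\<in>{0..c}. \<bar>g t - g s\<bar> \<le> M * \<bar>t - s\<bar>"
  using assms
proof (induction rule: piecewise_linear_induct)
  case zero
  then show ?case by (intro exI[of _ 0]) auto
next
  case (extend a b m)
  then obtain M where M: "M \<ge> 0" "\<And>s t. s \<in> {0..a} \<Longrightarrow> t \<in> {0..a} \<Longrightarrow> \<bar>g t - g s\<bar> \<le> M * \<bar>t - s\<bar>"
    by blast
  define N where "N = max M \<bar>of_int m\<bar>"
  have N: "N \<ge> 0" "M \<le> N" "\<bar>of_int m\<bar> \<le> N" using M by (auto simp: N_def)
  have 1: "\<bar>g t - g s\<bar> \<le> N * \<bar>t - s\<bar>" if "s \<in> {0..a}" "t \<in> {0..a}" for s t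
    using M(2)[OF that] mult_right_mono[OF N(2), of "\<bar>t - s\<bar>"] by linarith
  have 2: "\<bar>g t - g s\<bar> \<le> N * \<bar>t - s\<bar>" if "s \<in> {a..b}" "t \<in> {a..b}" for s t
  proof -
    have "g t - g s = of_int m * (t - s)"
    proof -
      have "g t = g a + of_int m * (t - a)" "g s = g a + of_int m * (s - a)"
        using extend.hyps(4) that by (meson atLeastAtMost_iff)+
      then show ?thesis by (simp add: algebra_simps)
    qed
    then show ?thesis
      using mult_right_mono[OF N(3), of "\<bar>t - s\<bar>"] by (simp add: abs_mult)
  qed
  have 3: "\<bar>g t - g s\<bar> \<le> N * (t - s)" if "0 \<le> s" "s \<le> t" "t \<le> b" for s t
  proof -
    consider "t \<le> a" | "a \<le> s" | "s \<le> a" "a \<le> t" by linarith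
    then show ?thesis
    proof cases
      case 3
      then show ?thesis using 1[of s a] 2[of a t] that by (auto simp: algebra_simps)
    qed (use 1[of s t] 2[of s t] that in auto)
  qed
  have "\<bar>g t - g s\<bar> \<le> N * \<bar>t - s\<bar>" if "s \<in> {0..b}" "t \<in> {0..b}" for s t
    using 3[of s t] 3[of t s] that by (cases "s \<le> t") (auto simp: abs_minus_commute)
  then show ?case using N(1) by blast
qed

lemma has_germs_map2:
  assumes "has_germs c f" "has_germs c g"
    and "\<And>t s m n. germ f t s m \<Longrightarrow> germ g t s n \<Longrightarrow> germ h t s (k m n t)"
  shows "has_germs c h"
  using assms unfolding has_germs_def by metis

lemma has_germs_add: "has_germs c f \<Longrightarrow> has_germs c g \<Longrightarrow> has_germs c (\<lambda>x. f x + g x)"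
  by (rule has_germs_map2[of c f g]) (auto intro: germ_add)

lemma has_germs_uminus: "has_germs c f \<Longrightarrow> has_germs c (\<lambda>x. - f x)"
  by (rule has_germs_map2[of c f f]) (auto intro: germ_uminus)

lemma has_germs_max_const: "has_germs c f \<Longrightarrow> has_germs c (\<lambda>x. max (f x) a)"
  by (rule has_germs_map2[of c f f]) (assumption, assumption, erule germ_max_const)

text \<open>The limit in \<open>outgoing_slope\<close> on a single interval. \<open>Lim\<close> is
  meaningful only where a limit exists, so its values are computed from germs by
  \<open>slope_eq\<close>.\<close>

definition slope :: "(real \<Rightarrow> real) \<Rightarrow> real \<Rightarrow> real \<Rightarrow> real" where
  "slope g t s = Lim (at_right 0) (\<lambda>h. (g (t + s * h) - g t) / h)"

lemma slope_eq:
  assumes "germ g t s m" shows "slope g t s = of_int m"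
  unfolding slope_def
proof (rule tendsto_Lim)
  have "\<forall>\<^sub>F h in at_right 0. of_int m = (g (t + s * h) - g t) / h"
    using assms eventually_at_right_less[of "0 :: real"] unfolding germ_def
    by eventually_elim simp
  then show "((\<lambda>h. (g (t + s * h) - g t) / h) \<longlongrightarrow> of_int m) (at_right 0)"
    by (rule tendsto_eventually[OF eventually_mono]) simp
qed simp

text \<open>Each linear piece contributes its slope with opposite signs at its two ends.\<close>

lemma piecewise_linear_slope_sum:
  assumes "piecewise_linear_int_slopes c g" "0 < c"
  obtains B where "finite B" "B \<subseteq> {0<..<c}"
    "\<And>t. 0 < t \<Longrightarrow> t < c \<Longrightarrow> t \<notin> B \<Longrightarrow> slope g t 1 + slope g t (-1) = 0"
    "slope g 0 1 + slope g c (-1) + (\<Sum>t\<in>B. slope g t 1 + slope g t (-1)) = 0"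
proof -
  let ?P = "\<lambda>c B. finite B \<and> B \<subseteq> {0<..<c} \<and>
    (\<forall>t. 0 < t \<and> t < c \<and> t \<notin> B \<longrightarrow> slope g t 1 + slope g t (-1) = 0) \<and>
    slope g 0 1 + slope g c (-1) + (\<Sum>t\<in>B. slope g t 1 + slope g t (-1)) = 0"
  \<comment> \<open>The case \<open>c = 0\<close> starts the induction but is kept apart: in an
    interval of length 0 no linear piece relates the two end slopes.\<close>
  have "c = 0 \<or> (\<exists>B. ?P c B)"
    using assms(1)
  proof (induction rule: piecewise_linear_induct)
    case zero
    then show ?case by simp
  next
    case (extend a b m)
    have lin: "g t = g a + of_int m * (t - a)" if "a \<le> t" "t \<le> b" for t
      using extend.hyps(4) that by (meson atLeastAtMost_iff)
    have right: "slope g t 1 = of_int m" if "a \<le> t" "t < b" for t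
      using slope_eq[OF germ_linear_right[OF lin that]] by simp
    have left: "slope g t (-1) = - of_int m" if "a < t" "t \<le> b" for t
      using slope_eq[OF germ_linear_left[OF lin that]] by simp
    show ?case
    proof (cases "a = 0")
      case True
      then have "?P b {}" using extend.hyps(2) left right by simp
      then show ?thesis by blast
    next
      case False
      then obtain B where B: "?P a B" using extend.IH by blast
      have "a \<notin> B" using B by auto
      have "slope g t 1 + slope g t (-1) = 0" if "0 < t" "t < b" "t \<notin> insert a B" for t
        using B left[of t] right[of t] that by (cases "t < a") auto
      \<comment> \<open>The former end term at \<open>a\<close> becomes half of the interior term
        there; the other half, the slope of the new piece, cancels the end term at
        \<open>b\<close>.\<close>
      moreover have "slope g 0 1 + slope g b (-1) +
          (\<Sum>t\<in>insert a B. slope g t 1 + slope g t (-1)) = 0"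
        using B \<open>a \<notin> B\<close> left[of b] right[of a] extend.hyps(2) by simp
      moreover have "finite (insert a B)" "insert a B \<subseteq> {0<..<b}"
        using B False extend.hyps(1,2) by auto
      ultimately have "?P b (insert a B)" by blast
      then show ?thesis by blast
    qed
  qed
  then show thesis using assms(2) that by auto
qed

text \<open>Left slopes are measured backwards, so \<open>convex\<close> says that the slope does
  not drop when passing \<open>t\<close>. The induction carries \<open>r 0 \<le> r x\<close> along
  with the inequality, since this bounds the growth on the next piece.\<close>

lemma convex_above_tangent:
  assumes "0 < c"
    and right: "\<And>t. 0 \<le> t \<Longrightarrow> t < c \<Longrightarrow> germ g t 1 (r t)"
    and left: "\<And>t. 0 < t \<Longrightarrow> t \<le> c \<Longrightarrow> germ g t (-1) (l t)"
    and convex: "\<And>t. 0 < t \<Longrightarrow> t < c \<Longrightarrow> 0 \<le> r t + l t"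
  shows "of_int (r 0) * c \<le> g c - g 0"
proof -
  define P where "P x \<longleftrightarrow> of_int (r 0) * x \<le> g x - g 0 \<and> (x < c \<longrightarrow> r 0 \<le> r x)" for x
  have "P c"
    using less_imp_le[OF assms(1)]
  proof (induction rule: real_induction)
    case zero
    then show ?case by (simp add: P_def)
  next
    case (step x)
    obtain \<epsilon> where \<epsilon>: "0 < \<epsilon>" "\<epsilon> \<le> c - x" "\<And>h. 0 \<le> h \<Longrightarrow> h \<le> \<epsilon> \<Longrightarrow>
        g (x + 1 * h) = g x + of_int (r x) * h"
      using germE[OF right[of x], of "c - x"] step by auto
    have lin: "g t = g x + of_int (r x) * (t - x)" if "x \<le> t" "t \<le> x + \<epsilon>" for t
      using \<epsilon>(3)[of "t - x"] that by simp
    \<comment> \<open>Half of \<open>\<epsilon>\<close> keeps \<open>z\<close> inside the linear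
      piece, where its right slope is still \<open>r x\<close>.\<close>
    have "P z" if z: "x < z" "z \<le> x + \<epsilon> / 2" for z
    proof -
      have "of_int (r 0) * (z - x) \<le> of_int (r x) * (z - x)"
        using step z \<open>x < c\<close> by (intro mult_right_mono) (auto simp: P_def)
      moreover have "germ g z 1 (r x)"
        by (rule germ_linear_right[of x "x + \<epsilon>", OF lin]) (use z \<epsilon> in auto)
      then have "r z = r x"
        using germ_unique[OF right[of z]] z \<epsilon> step by auto
      ultimately show ?thesis
        using step lin[of z] z \<epsilon> by (auto simp: P_def algebra_simps)
    qed
    then show ?case using \<epsilon> by (intro exI[of _ "x + \<epsilon> / 2"]) auto
  next
    case (limit x)
    obtain \<epsilon> where \<epsilon>: "0 < \<epsilon>" "\<epsilon> \<le> x" "\<And>h. 0 \<le> h \<Longrightarrow> h \<le> \<epsilon> \<Longrightarrow>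
        g (x + (-1) * h) = g x + of_int (l x) * h"
      using germE[OF left[of x], of x] limit by auto
    have lin: "g t = g (x - \<epsilon>) + of_int (- l x) * (t - (x - \<epsilon>))" if "x - \<epsilon> \<le> t" "t \<le> x" for t
      using \<epsilon>(3)[of "x - t"] \<epsilon>(3)[of \<epsilon>] \<epsilon>(1) that by (simp add: algebra_simps)
    \<comment> \<open>A point inside the last linear piece before \<open>x\<close>: its right slope
      is \<open>- l x\<close>, which gives \<open>r 0 \<le> r z = - l x \<le> r x\<close>.\<close>
    define z where "z = x - \<epsilon> / 2"
    have z: "0 < z" "z < x" "x - \<epsilon> < z" using \<epsilon> by (auto simp: z_def)
    have "germ g z 1 (- l x)"
      by (rule germ_linear_right[of "x - \<epsilon>" x, OF lin]) (use z in auto)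
    then have "r z = - l x"
      using germ_unique[OF right[of z]] z limit by auto
    moreover have "P z" using limit z by auto
    ultimately have le: "r 0 \<le> - l x" "of_int (r 0) * z \<le> g z - g 0"
      using z limit by (auto simp: P_def)
    have "of_int (r 0) * (x - z) \<le> of_int (- l x) * (x - z)"
      using le z by (intro mult_right_mono) linarith+
    moreover have "g x = g z + of_int (- l x) * (x - z)"
      using lin[of x] lin[of z] z \<epsilon> by (simp add: algebra_simps)
    ultimately have "of_int (r 0) * x \<le> g x - g 0"
      using le(2) by (simp add: algebra_simps)
    moreover have "r 0 \<le> r x" if "x < c"
      using convex[of x] limit le that by auto
    ultimately show ?case by (simp add: P_def)
  qed
  then show ?thesis by (simp add: P_def)
qed

text \<open>With \<open>s = -1\<close> this reverses an edge, so that statements about walking to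
  the right also serve for walking to the left.\<close>

lemma germ_shift:
  "germ (\<lambda>x. g (c + s * x)) t s' m \<longleftrightarrow> germ g (c + s * t) (s * s') m"
  by (simp add: germ_def algebra_simps)

lemma constant_until_nonzero_slope:
  assumes "0 \<le> c"
    and right: "\<And>t. 0 \<le> t \<Longrightarrow> t < c \<Longrightarrow> germ g t 1 (r t)"
    and left: "\<And>t. 0 < t \<Longrightarrow> t \<le> c \<Longrightarrow> germ g t (-1) (l t)"
  shows "\<exists>t. 0 \<le> t \<and> t \<le> c \<and> g t = g 0 \<and> (t = c \<or> r t \<noteq> 0)"
proof (rule ccontr)
  \<comment> \<open>Now every \<open>x < c\<close> at the level \<open>g 0\<close> has right slope
    0, so the level is carried on and reaches \<open>c\<close>, contrary to the assumption.\<close>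
  assume no: "\<not> ?thesis"
  have "g c = g 0"
    using assms(1)
  proof (induction rule: real_induction)
    case (step x)
    then have "r x = 0" using no by auto
    obtain \<epsilon> where \<epsilon>: "0 < \<epsilon>" "\<epsilon> \<le> c - x" "\<And>h. 0 \<le> h \<Longrightarrow> h \<le> \<epsilon> \<Longrightarrow>
        g (x + 1 * h) = g x + of_int (r x) * h"
      using germE[OF right[of x], of "c - x"] step by auto
    have "g z = g 0" if "x < z" "z \<le> x + \<epsilon>" for z
      using \<epsilon>(3)[of "z - x"] that \<open>r x = 0\<close> step(3) by simp
    then show ?case using \<epsilon> by (intro exI[of _ "x + \<epsilon>"]) auto
  next
    case (limit x)
    obtain \<epsilon> where \<epsilon>: "0 < \<epsilon>" "\<epsilon> \<le> x" "\<And>h. 0 \<le> h \<Longrightarrow> h \<le> \<epsilon> \<Longrightarrow>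
        g (x + (-1) * h) = g x + of_int (l x) * h"
      using germE[OF left[of x], of x] limit by auto
    \<comment> \<open>Equal values at two different distances force \<open>l x = 0\<close>.\<close>
    have "g x + of_int (l x) * \<epsilon> = g 0" "g x + of_int (l x) * (\<epsilon> / 2) = g 0"
      using \<epsilon>(3)[of \<epsilon>] \<epsilon>(3)[of "\<epsilon> / 2"] limit(3)[of "x - \<epsilon>"] limit(3)[of "x - \<epsilon> / 2"] \<epsilon>(1,2) by auto
    then show ?case using \<epsilon>(1) by auto
  qed simp
  then show False using no assms(1) by auto
qed

text \<open>The property is stable under enlarging \<open>B\<close>, so finitely many functions have
  a common set of breakpoints, the union of theirs.\<close>

lemma piecewise_linear_breakpoints:
  assumes "piecewise_linear_int_slopes c g"
  obtains B where "finite B" "\<And>a b. 0 \<le> a \<Longrightarrow> a < b \<Longrightarrow> b \<le> c \<Longrightarrow> {a<..<b} \<inter> B = {} \<Longrightarrow>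
      \<exists>m :: int. \<forall>t\<in>{a..b}. g t = g a + of_int m * (t - a)"
proof -
  have "\<exists>B. finite B \<and> (\<forall>a b. 0 \<le> a \<and> a < b \<and> b \<le> c \<and> {a<..<b} \<inter> B = {} \<longrightarrow>
      (\<exists>m :: int. \<forall>t\<in>{a..b}. g t = g a + of_int m * (t - a)))"
    using assms
  proof (induction rule: piecewise_linear_induct)
    case zero
    then show ?case by (intro exI[of _ "{}"]) auto
  next
    case (extend a0 b0 m0)
    obtain B where B: "finite B" "\<And>a b. 0 \<le> a \<Longrightarrow> a < b \<Longrightarrow> b \<le> a0 \<Longrightarrow> {a<..<b} \<inter> B = {} \<Longrightarrow>
      \<exists>m :: int. \<forall>t\<in>{a..b}. g t = g a + of_int m * (t - a)"
      using extend.IH by blast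
    have "\<exists>m :: int. \<forall>t\<in>{a..b}. g t = g a + of_int m * (t - a)"
      if ab: "0 \<le> a" "a < b" "b \<le> b0" "{a<..<b} \<inter> insert a0 B = {}" for a b
    proof (cases "b \<le> a0")
      case True
      then show ?thesis using B(2)[of a b] ab by simp
    next
      case False
      then have "a0 \<le> a" using ab by auto
      have "g t = g a + of_int m0 * (t - a)" if "t \<in> {a..b}" for t
      proof -
        have "g t = g a0 + of_int m0 * (t - a0)" "g a = g a0 + of_int m0 * (a - a0)"
          using extend.hyps(4) that ab \<open>a0 \<le> a\<close>
              by (meson atLeastAtMost_iff order_trans less_imp_le)+
        then show ?thesis by (simp add: algebra_simps)
      qed
      then show ?thesis by blast
    qed
    then show ?case using B(1) by (intro exI[of _ "insert a0 B"]) auto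
  qed
  then show thesis using that by blast
qed


subsection \<open>Rational functions on a metric graph\<close>

locale metric_graph = fin_digraph G for G :: "('a, 'b) pre_digraph" +
  fixes l :: "'b \<Rightarrow> real"
  assumes conn: "Digraph_Component.connected G"
    and pos: "e \<in> arcs G \<Longrightarrow> 0 < l e"
begin

abbreviation pt :: "'b \<Rightarrow> real \<Rightarrow> ('a, 'b) mpoint" where
  "pt \<equiv> edge_point G l"

lemma length_simps [simp]: "e \<in> arcs G \<Longrightarrow> 0 < l e" "e \<in> arcs G \<Longrightarrow> 0 \<le> l e" "e \<in> arcs G \<Longrightarrow> l e \<noteq> 0"
  using pos by (fastforce intro: less_imp_le)+

definition regular :: "(('a, 'b) mpoint \<Rightarrow> real) \<Rightarrow> bool" where
  "regular f \<longleftrightarrow> (\<forall>e\<in>arcs G. has_germs (l e) (\<lambda>t. f (pt e t)))"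

lemma pt_in_points: "e \<in> arcs G \<Longrightarrow> 0 \<le> t \<Longrightarrow> t \<le> l e \<Longrightarrow> pt e t \<in> points G l"
  by (rule edge_point_in_points) (auto intro: wf_digraph)

lemma continuous_map_Lipschitz:
  assumes "\<And>p q. p \<in> points G l \<Longrightarrow> q \<in> points G l \<Longrightarrow> \<bar>f q - f p\<bar> \<le> M * path_dist G l p q"
  shows "continuous_map (metric_graph_topology G l) euclideanreal f"
proof -
  interpret M: Metric_space "points G l" "path_dist G l"
    by (rule Metric_space_metric_graph[OF _ conn pos]) (unfold_locales)
  define N where "N = \<bar>M\<bar> + 1"
  have "N > 0" by (simp add: N_def)
  have le: "\<bar>f q - f p\<bar> \<le> N * path_dist G l p q" if "p \<in> points G l" "q \<in> points G l" for p q
  proof -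
    have "M * path_dist G l p q \<le> N * path_dist G l p q"
      by (intro mult_right_mono) (auto simp: N_def)
    then show ?thesis using assms[OF that] by linarith
  qed
  show ?thesis
    unfolding continuous_map_def metric_graph_topology_def
  proof (intro conjI allI impI)
    fix U :: "real set" assume U: "openin euclideanreal U"
    show "openin M.mtopology {x \<in> topspace M.mtopology. f x \<in> U}"
      unfolding M.openin_mtopology
    proof (intro conjI allI impI)
      fix x assume x: "x \<in> {x \<in> topspace M.mtopology. f x \<in> U}"
      then obtain \<epsilon> where \<epsilon>: "\<epsilon> > 0" "\<And>y. \<bar>y - f x\<bar> < \<epsilon> \<Longrightarrow> y \<in> U"
        using U by (auto simp: open_dist dist_real_def)
      have "f y \<in> U" if "y \<in> M.mball x (\<epsilon> / N)" for y
      proof -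
        have "N * path_dist G l x y < \<epsilon>" using that \<open>N > 0\<close> by (auto simp: field_simps)
        then show ?thesis using le[of x y] that \<epsilon>(2)[of "f y"] by auto
      qed
      then show "\<exists>r>0. M.mball x r \<subseteq> {x \<in> topspace M.mtopology. f x \<in> U}"
        using \<epsilon>(1) \<open>N > 0\<close> by (intro exI[of _ "\<epsilon> / N"]) auto
    qed auto
  qed auto
qed

text \<open>Continuity is automatic: \<open>f\<close> lives on the glued points, so its values on
  edges agree at shared vertices, and the finitely many edges have a common Lipschitz constant,
  which passes to the path distance.\<close>

lemma rational_function_iff: "rational_function G l f \<longleftrightarrow> regular f"
proof
  assume f: "regular f"
  then have pl: "piecewise_linear_int_slopes (l e) (\<lambda>t. f (pt e t))" if "e \<in> arcs G" for e
    using piecewise_linear_iff_has_germs[of "l e"] pos[OF that] that by (auto simp: regular_def)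
  then have "\<exists>M\<ge>0. \<forall>s\<in>{0..l e}. \<forall>t\<in>{0..l e}. \<bar>f (pt e t) - f (pt e s)\<bar> \<le> M * \<bar>t - s\<bar>"
    if "e \<in> arcs G" for e
    using piecewise_linear_Lipschitz that by blast
  then obtain M where M: "\<And>e. e \<in> arcs G \<Longrightarrow> M e \<ge> 0"
    "\<And>e s t. e \<in> arcs G \<Longrightarrow> s \<in> {0..l e} \<Longrightarrow> t \<in> {0..l e} \<Longrightarrow>
      \<bar>f (pt e t) - f (pt e s)\<bar> \<le> M e * \<bar>t - s\<bar>"
    by metis
  define N where "N = (\<Sum>e\<in>arcs G. M e)"
  have "0 \<le> N" using M(1) by (auto simp: N_def intro: sum_nonneg)
  have N: "\<bar>f (pt e t) - f (pt e s)\<bar> \<le> N * \<bar>t - s\<bar>"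
    if "e \<in> arcs G" "s \<in> {0..l e}" "t \<in> {0..l e}" for e s t
  proof -
    have "M e \<le> N" unfolding N_def using that M(1) by (intro member_le_sum) auto
    then have "M e * \<bar>t - s\<bar> \<le> N * \<bar>t - s\<bar>" by (intro mult_right_mono) auto
    then show ?thesis using M(2)[OF that] by linarith
  qed
  have "continuous_map (metric_graph_topology G l) euclideanreal f"
    by (rule continuous_map_Lipschitz[of f N])
      (rule path_dist_Lipschitz[OF wf_digraph conn pos _ _ \<open>0 \<le> N\<close> N])
  then show "rational_function G l f" using pl by (simp add: rational_function_def)
next
  assume "rational_function G l f"
  then show "regular f"
    using piecewise_linear_iff_has_germs less_imp_le[OF pos]
    by (auto simp: regular_def rational_function_def)
qed

lemma regular_add: "regular f \<Longrightarrow> regular g \<Longrightarrow> regular (\<lambda>x. f x + g x)"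
  by (simp add: regular_def has_germs_add)

lemma regular_uminus: "regular f \<Longrightarrow> regular (\<lambda>x. - f x)"
  by (simp add: regular_def has_germs_uminus)

lemma regular_max_const: "regular f \<Longrightarrow> regular (\<lambda>x. max (f x) a)"
  by (simp add: regular_def has_germs_max_const)

lemma regular_const: "regular (\<lambda>x. a)"
  by (auto simp: regular_def has_germs_def intro: germ_const)

lemma outgoing_slope_eq: "outgoing_slope G l f (e, t, s) = slope (\<lambda>t. f (pt e t)) t s"
  by (simp add: outgoing_slope_def slope_def)

lemma directions_Inl:
  "directions G l (Inl v) =
     (\<lambda>e. (e, 0, 1)) ` {e \<in> arcs G. tail G e = v} \<union>
     (\<lambda>e. (e, l e, - 1)) ` {e \<in> arcs G. head G e = v}"
  by (auto simp: directions_def edge_point_def image_iff split: if_splits)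

lemma directions_Inr:
  assumes "e \<in> arcs G" "0 < t" "t < l e"
  shows "directions G l (Inr (e, t)) = {(e, t, 1), (e, t, - 1)}"
  using assms by (auto simp: directions_def edge_point_def split: if_splits)

lemma points_cases [consumes 1, case_names vertex interior]:
  assumes "p \<in> points G l"
  obtains v where "p = Inl v" "v \<in> verts G"
    | e t where "p = Inr (e, t)" "e \<in> arcs G" "0 < t" "t < l e"
  using assms by (auto simp: points_def)

lemma direction_germ:
  assumes "regular f" "(e, t, s) \<in> directions G l p"
  shows "\<exists>m. germ (\<lambda>t. f (pt e t)) t s m"
proof -
  have "has_germs (l e) (\<lambda>t. f (pt e t))" using assms by (simp add: regular_def directions_def)
  then show ?thesis
    using assms(2) unfolding has_germs_def directions_def by (elim CollectE case_prodE) auto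
qed

text \<open>The divisor of \<open>f\<close> as a real-valued function, available before integrality
  and finite support are known.\<close>

definition slope_sum :: "(('a, 'b) mpoint \<Rightarrow> real) \<Rightarrow> ('a, 'b) mpoint \<Rightarrow> real" where
  "slope_sum f p = (\<Sum>d\<in>directions G l p. outgoing_slope G l f d)"

lemma slope_sum_Inl:
  "slope_sum f (Inl v) =
     (\<Sum>e | e \<in> arcs G \<and> tail G e = v. slope (\<lambda>t. f (pt e t)) 0 1) +
     (\<Sum>e | e \<in> arcs G \<and> head G e = v. slope (\<lambda>t. f (pt e t)) (l e) (- 1))"
  unfolding slope_sum_def directions_Inl
  by (subst sum.union_disjoint) (auto simp: sum.reindex inj_on_def outgoing_slope_eq)

lemma slope_sum_Inr:
  assumes "e \<in> arcs G" "0 < t" "t < l e"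
  shows "slope_sum f (Inr (e, t)) = slope (\<lambda>t. f (pt e t)) t 1 + slope (\<lambda>t. f (pt e t)) t (- 1)"
  using assms by (simp add: slope_sum_def directions_Inr outgoing_slope_eq)

lemma slope_sum_Ints:
  assumes "regular f" shows "slope_sum f p \<in> \<int>"
  unfolding slope_sum_def
proof (rule Ints_sum)
  fix d assume "d \<in> directions G l p"
  then show "outgoing_slope G l f d \<in> \<int>"
    using direction_germ[OF assms] slope_eq by (cases d) (metis Ints_of_int outgoing_slope_eq)
qed

lemma slope_sum_add:
  assumes "regular f" "regular g"
  shows "slope_sum (\<lambda>x. f x + g x) p = slope_sum f p + slope_sum g p"
  unfolding slope_sum_def sum.distrib[symmetric]
proof (rule sum.cong)
  fix d assume d: "d \<in> directions G l p"
  obtain e t s where [simp]: "d = (e, t, s)" by (cases d)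
  obtain m where m: "germ (\<lambda>t. f (pt e t)) t s m" using direction_germ[OF assms(1), of e t s p] d
      by auto
  obtain n where n: "germ (\<lambda>t. g (pt e t)) t s n" using direction_germ[OF assms(2), of e t s p] d
      by auto
  show "outgoing_slope G l (\<lambda>x. f x + g x) d = outgoing_slope G l f d + outgoing_slope G l g d"
    using slope_eq[OF m] slope_eq[OF n] slope_eq[OF germ_add[OF m n]]
        by (simp add: outgoing_slope_eq)
qed simp

lemma slope_sum_uminus:
  assumes "regular f" shows "slope_sum (\<lambda>x. - f x) p = - slope_sum f p"
  unfolding slope_sum_def sum_negf[symmetric]
proof (rule sum.cong)
  fix d assume d: "d \<in> directions G l p"
  obtain e t s where [simp]: "d = (e, t, s)" by (cases d)
  obtain m where m: "germ (\<lambda>t. f (pt e t)) t s m" using direction_germ[OF assms, of e t s p] d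
      by auto
  show "outgoing_slope G l (\<lambda>x. - f x) d = - outgoing_slope G l f d"
    using slope_eq[OF m] slope_eq[OF germ_uminus[OF m]] by (simp add: outgoing_slope_eq)
qed simp

text \<open>Principal divisors have finite support and degree 0. Both follow edge by edge from
  \<open>piecewise_linear_slope_sum\<close>, after the slopes at the vertices have been regrouped by
  edges.\<close>

lemma slope_sum_finite_support:
  assumes "regular f"
  obtains Q where "finite Q" "Q \<subseteq> points G l" "\<And>p. p \<in> points G l \<Longrightarrow> p \<notin> Q \<Longrightarrow> slope_sum f p = 0"
    "(\<Sum>p\<in>Q. slope_sum f p) = 0"
proof -
  define r where "r e t = slope (\<lambda>t. f (pt e t)) t 1" for e t
  define r' where "r' e t = slope (\<lambda>t. f (pt e t)) t (- 1)" for e t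
  let ?P = "\<lambda>e B. finite B \<and> B \<subseteq> {0<..<l e} \<and>
    (\<forall>t. 0 < t \<and> t < l e \<and> t \<notin> B \<longrightarrow> r e t + r' e t = 0) \<and>
    r e 0 + r' e (l e) + (\<Sum>t\<in>B. r e t + r' e t) = 0"
  have ex: "\<exists>B. ?P e B" if e: "e \<in> arcs G" for e
  proof -
    have pl: "piecewise_linear_int_slopes (l e) (\<lambda>t. f (pt e t))"
      using assms e piecewise_linear_iff_has_germs[OF less_imp_le[OF pos[OF e]]]
      by (simp add: regular_def)
    obtain B where "finite B" "B \<subseteq> {0<..<l e}"
      "\<And>t. 0 < t \<Longrightarrow> t < l e \<Longrightarrow> t \<notin> B \<Longrightarrow> r e t + r' e t = 0"
      "r e 0 + r' e (l e) + (\<Sum>t\<in>B. r e t + r' e t) = 0"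
      by (rule piecewise_linear_slope_sum[OF pl pos[OF e]]) (rule that; simp add: r_def r'_def)
    then show ?thesis by (intro exI[of _ B]) simp
  qed
  define B where "B e = (SOME B. ?P e B)" for e
  have "?P e (B e)" if "e \<in> arcs G" for e
    unfolding B_def by (rule someI_ex[OF ex[OF that]])
  then have B: "\<And>e. e \<in> arcs G \<Longrightarrow> finite (B e)" "\<And>e. e \<in> arcs G \<Longrightarrow> B e \<subseteq> {0<..<l e}"
    "\<And>e t. e \<in> arcs G \<Longrightarrow> 0 < t \<Longrightarrow> t < l e \<Longrightarrow> t \<notin> B e \<Longrightarrow> r e t + r' e t = 0"
    "\<And>e. e \<in> arcs G \<Longrightarrow> r e 0 + r' e (l e) + (\<Sum>t\<in>B e. r e t + r' e t) = 0"
    by blast+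
  define Q1 :: "('a, 'b) mpoint set" where "Q1 = Inl ` verts G"
  define Q2 :: "('a, 'b) mpoint set" where "Q2 = Inr ` (SIGMA e:arcs G. B e)"
  have fin: "finite Q1" "finite Q2" using B(1) by (auto simp: Q1_def Q2_def)
  have "(\<Sum>p\<in>Q1. slope_sum f p) =
      (\<Sum>v\<in>verts G. \<Sum>e | e \<in> arcs G \<and> tail G e = v. r e 0) +
      (\<Sum>v\<in>verts G. \<Sum>e | e \<in> arcs G \<and> head G e = v. r' e (l e))"
    unfolding Q1_def r_def r'_def by (subst sum.reindex) (auto simp: slope_sum_Inl sum.distrib)
  also have "(\<Sum>v\<in>verts G. \<Sum>e | e \<in> arcs G \<and> tail G e = v. r e 0) = (\<Sum>e\<in>arcs G. r e 0)"
    by (rule sum.group) auto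
  also have "(\<Sum>v\<in>verts G. \<Sum>e | e \<in> arcs G \<and> head G e = v. r' e (l e)) = (\<Sum>e\<in>arcs G. r' e (l e))"
    by (rule sum.group) auto
  finally have 1: "(\<Sum>p\<in>Q1. slope_sum f p) = (\<Sum>e\<in>arcs G. r e 0) + (\<Sum>e\<in>arcs G. r' e (l e))" .
  have "(\<Sum>p\<in>Q2. slope_sum f p) = (\<Sum>(e, t)\<in>(SIGMA e:arcs G. B e). slope_sum f (Inr (e, t)))"
    unfolding Q2_def by (subst sum.reindex) (auto simp: case_prod_unfold)
  also have "\<dots> = (\<Sum>(e, t)\<in>(SIGMA e:arcs G. B e). r e t + r' e t)"
    using B(2) by (intro sum.cong) (fastforce simp: r_def r'_def slope_sum_Inr)+
  also have "\<dots> = (\<Sum>e\<in>arcs G. \<Sum>t\<in>B e. r e t + r' e t)"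
    using B(1) by (subst sum.Sigma) auto
  finally have 2: "(\<Sum>p\<in>Q2. slope_sum f p) = (\<Sum>e\<in>arcs G. \<Sum>t\<in>B e. r e t + r' e t)" .
  have "(\<Sum>p\<in>Q1 \<union> Q2. slope_sum f p) =
      (\<Sum>e\<in>arcs G. r e 0 + r' e (l e) + (\<Sum>t\<in>B e. r e t + r' e t))"
    using fin 1 2 by (subst sum.union_disjoint) (auto simp: Q1_def Q2_def sum.distrib)
  also have "\<dots> = 0" using B(4) by simp
  finally show thesis
    using fin B
    by (intro that[of "Q1 \<union> Q2"])
      (force simp: Q1_def Q2_def points_def r_def r'_def slope_sum_Inr)+
qed

lemma metric_principal_divisors_iff:
  "D \<in> metric_principal_divisors G l \<longleftrightarrow> D \<in> divisors (points G l) \<and>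
     (\<exists>f. regular f \<and> (\<forall>p\<in>points G l. of_int (Poly_Mapping.lookup D p) = slope_sum f p))"
  by (auto simp: metric_principal_divisors_def rational_function_iff slope_sum_def)

lemma regular_principal_divisor:
  assumes "regular f"
  obtains D where "D \<in> divisors (points G l)"
    "\<And>p. p \<in> points G l \<Longrightarrow> of_int (Poly_Mapping.lookup D p) = slope_sum f p"
proof -
  obtain Q where Q: "finite Q" "Q \<subseteq> points G l"
    "\<And>p. p \<in> points G l \<Longrightarrow> p \<notin> Q \<Longrightarrow> slope_sum f p = 0" "(\<Sum>p\<in>Q. slope_sum f p) = 0"
    by (rule slope_sum_finite_support[OF assms]) (rule that)
  \<comment> \<open>The slope sum is already an integer; the floor only changes its type.\<close>
  define h where "h p = (if p \<in> points G l then \<lfloor>slope_sum f p\<rfloor> else 0)" for p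
  have "{p. h p \<noteq> 0} \<subseteq> Q" using Q(3) by (force simp: h_def split: if_splits)
  then have "finite {p. h p \<noteq> 0}" using Q(1) finite_subset by blast
  then have lookup: "Poly_Mapping.lookup (Abs_poly_mapping h) = h" by (rule lookup_Abs_poly_mapping)
  show thesis
    by (rule that[of "Abs_poly_mapping h"])
      (use slope_sum_Ints[OF assms] in \<open>auto simp: lookup h_def intro!: divisorsI elim: Ints_cases\<close>)
qed

text \<open>The effective divisor is determined by the function: it is \<open>D\<close> plus the
  divisor of \<open>f\<close>. The sign changes because \<open>equivalent\<close> subtracts the
  target from \<open>D\<close>.\<close>

lemma winnable_iff:
  assumes "D \<in> divisors (points G l)"
  shows "winnable (points G l) (metric_principal_divisors G l) D \<longleftrightarrow>
    (\<exists>f. regular f \<and> (\<forall>p\<in>points G l. 0 \<le> of_int (Poly_Mapping.lookup D p) + slope_sum f p))"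
    (is "_ \<longleftrightarrow> ?R")
proof
  assume "winnable (points G l) (metric_principal_divisors G l) D"
  then obtain F f where F: "effective F" "regular f"
    "\<And>p. p \<in> points G l \<Longrightarrow> of_int (Poly_Mapping.lookup (D - F) p) = slope_sum f p"
    by (auto simp: winnable_def equivalent_def metric_principal_divisors_iff)
  have "0 \<le> of_int (Poly_Mapping.lookup D p) + slope_sum (\<lambda>x. - f x) p" if "p \<in> points G l" for p
  proof -
    have "of_int (Poly_Mapping.lookup D p) + slope_sum (\<lambda>x. - f x) p =
        (of_int (Poly_Mapping.lookup F p) :: real)"
      using F(3)[OF that] by (simp add: slope_sum_uminus[OF F(2)] lookup_minus)
    then show ?thesis using F(1) by (simp add: effective_def)
  qed
  then show ?R using regular_uminus[OF F(2)] by blast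
next
  assume ?R
  then obtain f where f: "regular f" "\<And>p. p \<in> points G l \<Longrightarrow>
      0 \<le> of_int (Poly_Mapping.lookup D p) + slope_sum f p"
    by blast
  obtain D' where D': "D' \<in> divisors (points G l)"
    "\<And>p. p \<in> points G l \<Longrightarrow> of_int (Poly_Mapping.lookup D' p) = slope_sum f p"
    by (rule regular_principal_divisor[OF f(1)]) (rule that)
  have div: "D + D' \<in> divisors (points G l)" using assms D'(1) by (rule divisors_add)
  have "0 \<le> Poly_Mapping.lookup (D + D') p" for p
  proof (cases "p \<in> points G l")
    case True
    have "(0 :: real) \<le> of_int (Poly_Mapping.lookup (D + D') p)"
      using f(2)[OF True] D'(2)[OF True] by (simp add: lookup_add)
    then show ?thesis by simp
  next
    case False
    then show ?thesis using divisors_lookup_eq_0[OF div False] by simp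
  qed
  then have "effective (D + D')" by (simp add: effective_def)
  moreover have "- D' \<in> metric_principal_divisors G l"
    unfolding metric_principal_divisors_iff
    using D' f(1) by (auto simp: divisors_def slope_sum_uminus intro!: exI[of _ "\<lambda>x. - f x"]
        regular_uminus)
  ultimately show "winnable (points G l) (metric_principal_divisors G l) D"
    using div by (auto simp: winnable_def equivalent_def)
qed

sublocale divisor_theory "points G l" "metric_principal_divisors G l"
proof
  have "verts G \<noteq> {}"
    using conn unfolding Digraph_Component.connected_def strongly_connected_def
    by (simp add: mk_symmetric_def)
  then show "points G l \<noteq> {}" by (auto simp: points_def)
  fix D assume "D \<in> metric_principal_divisors G l"
  then obtain f where f: "D \<in> divisors (points G l)" "regular f"
    "\<And>p. p \<in> points G l \<Longrightarrow> of_int (Poly_Mapping.lookup D p) = slope_sum f p"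
    by (auto simp: metric_principal_divisors_iff)
  obtain Q where Q: "finite Q" "Q \<subseteq> points G l"
    "\<And>p. p \<in> points G l \<Longrightarrow> p \<notin> Q \<Longrightarrow> slope_sum f p = 0" "(\<Sum>p\<in>Q. slope_sum f p) = 0"
    by (rule slope_sum_finite_support[OF f(2)]) (rule that)
  have "Poly_Mapping.keys D \<subseteq> Q"
  proof
    fix p assume p: "p \<in> Poly_Mapping.keys D"
    then have "p \<in> points G l" using f(1) by (auto simp: divisors_def)
    then show "p \<in> Q" using Q(3)[of p] f(3)[of p] p by (auto simp: in_keys_iff)
  qed
  then have "(of_int (div_degree D) :: real) = (\<Sum>p\<in>Q. of_int (Poly_Mapping.lookup D p))"
    using Q(1) by (simp add: div_degree_eq_sum)
  also have "\<dots> = (\<Sum>p\<in>Q. slope_sum f p)" using Q(2) f(3) by (intro sum.cong) auto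
  finally show "div_degree D = 0" using Q(4) by simp
qed

end


subsection \<open>Rank-determining sets\<close>

context metric_graph
begin

text \<open>Slope by slope: below \<open>a\<close> the truncation is constant, at \<open>a\<close>
  only positive slopes survive, above \<open>a\<close> nothing changes. At the level itself both
  bounds hold, which lets \<open>winnable_between\<close> change from one effective divisor to the
  other.\<close>

lemma slope_sum_max_const:
  assumes f: "regular f" and p: "p \<in> points G l"
  shows "f p \<le> a \<Longrightarrow> 0 \<le> slope_sum (\<lambda>x. max (f x) a) p"
    and "a \<le> f p \<Longrightarrow> slope_sum f p \<le> slope_sum (\<lambda>x. max (f x) a) p"
proof -
  have *: "outgoing_slope G l (\<lambda>x. max (f x) a) d =
      (if f p > a then outgoing_slope G l f d
       else if f p = a then max (outgoing_slope G l f d) 0 else 0)"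
    if d: "d \<in> directions G l p" for d
  proof -
    obtain e t s where [simp]: "d = (e, t, s)" by (cases d)
    obtain m where m: "germ (\<lambda>t. f (pt e t)) t s m" using direction_germ[OF f, of e t s p] d by auto
    have "pt e t = p" using d by (simp add: directions_def)
    then show ?thesis
      using slope_eq[OF m] slope_eq[OF germ_max_const[OF m, of a]]
      by (auto simp: outgoing_slope_eq of_int_max)
  qed
  show "f p \<le> a \<Longrightarrow> 0 \<le> slope_sum (\<lambda>x. max (f x) a) p"
    unfolding slope_sum_def by (rule sum_nonneg) (auto simp: *)
  show "a \<le> f p \<Longrightarrow> slope_sum f p \<le> slope_sum (\<lambda>x. max (f x) a) p"
    unfolding slope_sum_def by (rule sum_mono) (auto simp: *)
qed

lemma slope_germs:
  assumes "regular f" "e \<in> arcs G"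
  obtains r r' where "\<And>t. 0 \<le> t \<Longrightarrow> t < l e \<Longrightarrow> germ (\<lambda>t. f (pt e t)) t 1 (r t)"
    "\<And>t. 0 < t \<Longrightarrow> t \<le> l e \<Longrightarrow> germ (\<lambda>t. f (pt e t)) t (- 1) (r' t)"
  using assms unfolding regular_def has_germs_def by metis

text \<open>
  The chips at \<open>a\<close> and \<open>b\<close> move towards each other at unit speed until the first of them reaches
  \<open>c\<close>.
\<close>

lemma fire_segment:
  assumes e: "e \<in> arcs G" and abc: "0 \<le> a" "a < c" "c < b" "b \<le> l e"
  obtains w where "regular w"
    "\<And>p. p \<in> points G l \<Longrightarrow>
        of_bool (p = pt e c) - of_bool (p = pt e a) - of_bool (p = pt e b) \<le> slope_sum w p"
proof -
  define \<delta> where "\<delta> = min (c - a) (b - c)"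
  have \<delta>: "0 < \<delta>" "a + \<delta> \<le> b - \<delta>" "c = a + \<delta> \<or> c = b - \<delta>" using abc by (auto simp: \<delta>_def min_def)
  \<comment> \<open>A trapezoid pointing down. Its slope sum is -1 at \<open>a\<close> and at
    \<open>b\<close> and positive at \<open>a + \<delta>\<close> and \<open>b - \<delta>\<close>,
    one of which is \<open>c\<close>. A chip at the other one is the reason for an inequality in the
    claim.\<close>
  define W where "W t = - max 0 (min \<delta> (min (t - a) (b - t)))" for t
  define w :: "('a, 'b) mpoint \<Rightarrow> real"
      where "w = case_sum (\<lambda>_. 0) (\<lambda>(e', t). if e' = e then W t else 0)"
  \<comment> \<open>\<open>W\<close> vanishes at both ends of the edge and so fits the value 0 at
    the vertices.\<close>
  have w: "w (pt e' t) = (if e' = e then W t else 0)" for e' t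
    using abc by (auto simp: w_def edge_point_def W_def)
  have right: "germ W t 1 (if t < a then 0 else if t < a + \<delta> then -1 else if t < b - \<delta> then 0
      else if t < b then 1 else 0)"
    for t
  proof -
    consider "t < a" | "a \<le> t" "t < a + \<delta>" | "a + \<delta> \<le> t" "t < b - \<delta>" | "b - \<delta> \<le> t" "t < b" | "b \<le> t"
      by linarith
    then show ?thesis
    proof cases
      case 1
      then show ?thesis using germ_linear_right[of t a W 0 t] by (simp add: W_def)
    next
      case 2
      then show ?thesis using germ_linear_right[of a "a + \<delta>" W "-1" t] \<delta> by (simp add: W_def)
    next
      case 3
      then show ?thesis using germ_linear_right[of "a + \<delta>" "b - \<delta>" W 0 t] \<delta> by (simp add: W_def)
    next
      case 4
      then show ?thesis using germ_linear_right[of "b - \<delta>" b W 1 t] \<delta> by (simp add: W_def)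
    next
      case 5
      then show ?thesis using germ_linear_right[of t "t + 1" W 0 t] \<delta> by (simp add: W_def)
    qed
  qed
  have left: "germ W t (-1) (if t \<le> a then 0 else if t \<le> a + \<delta> then 1 else if t \<le> b - \<delta> then 0
      else if t \<le> b then -1 else 0)"
    for t
  proof -
    consider "t \<le> a" | "a < t" "t \<le> a + \<delta>" | "a + \<delta> < t" "t \<le> b - \<delta>" | "b - \<delta> < t" "t \<le> b" | "b < t"
      by linarith
    then show ?thesis
    proof cases
      case 1
      then show ?thesis using germ_linear_left[of "t - 1" t W 0 t] by (simp add: W_def)
    next
      case 2
      then show ?thesis using germ_linear_left[of a "a + \<delta>" W "-1" t] \<delta> by (simp add: W_def)
    next
      case 3
      then show ?thesis using germ_linear_left[of "a + \<delta>" "b - \<delta>" W 0 t] \<delta> by (simp add: W_def)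
    next
      case 4
      then show ?thesis using germ_linear_left[of "b - \<delta>" b W 1 t] \<delta> by (simp add: W_def)
    next
      case 5
      then show ?thesis using germ_linear_left[of b t W 0 t] \<delta> by (simp add: W_def)
    qed
  qed
  have reg: "regular w"
    unfolding regular_def w
  proof
    fix e'
    show "has_germs (l e') (\<lambda>t. if e' = e then W t else 0)"
      by (cases "e' = e") (auto simp: has_germs_def intro: left right germ_const)
  qed
  have slopes: "slope (\<lambda>t. w (pt e' t)) t s = (if e' = e then slope W t s else 0)" for e' t s
    unfolding w using slope_eq[OF germ_const[of 0 t s]] by auto
  have "of_bool (p = pt e c) - of_bool (p = pt e a) - of_bool (p = pt e b) \<le> slope_sum w p"
    if p: "p \<in> points G l" for p
    using p
  proof (cases p rule: points_cases)
    case (vertex v)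
    have "slope_sum w p = (if tail G e = v then slope W 0 1 else 0)
        + (if head G e = v then slope W (l e) (-1) else 0)"
      unfolding vertex slope_sum_Inl slopes using e by (simp add: sum.delta)
    also have "slope W 0 1 = - of_bool (a = 0)"
      using slope_eq[OF right[of 0]] abc \<delta> by auto
    also have "slope W (l e) (-1) = - of_bool (b = l e)"
      using slope_eq[OF left[of "l e"]] abc \<delta> by auto
    finally show ?thesis using vertex abc by (auto simp: edge_point_def)
  next
    case (interior e' t)
    show ?thesis
    proof (cases "e' = e")
      case True
      have "slope_sum w p = slope W t 1 + slope W t (-1)"
        using interior True by (simp add: slope_sum_Inr slopes)
      also have "of_bool (t = c) - of_bool (t = a) - of_bool (t = b) \<le> slope W t 1 + slope W t (-1)"
        unfolding slope_eq[OF right] slope_eq[OF left] using abc \<delta> by auto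
      finally show ?thesis using interior True abc by (auto simp: edge_point_def)
    next
      case False
      then have "slope_sum w p = 0" using interior by (simp add: slope_sum_Inr slopes)
      then show ?thesis using interior False by (auto simp: edge_point_def)
    qed
  qed
  then show thesis using that reg by blast
qed

text \<open>
  Truncating the function \<open>f\<close> that leads from an effective divisor with a chip at \<open>a\<close> to one with a
  chip at \<open>b\<close> from below at the level \<open>f c\<close> gives an effective divisor with chips on both sides
  of \<open>c\<close>; these can be moved inwards. If the edge were a loop, the two chips could be the same one.
\<close>

lemma winnable_between:
  assumes loopless: "tail G e \<noteq> head G e"
    and D: "D \<in> divisors (points G l)" and e: "e \<in> arcs G"
    and le: "0 \<le> a" "a < c" "c < b" "b \<le> l e"
    and wa: "winnable (points G l) (metric_principal_divisors G l) (D - chip (pt e a))"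
    and wb: "winnable (points G l) (metric_principal_divisors G l) (D - chip (pt e b))"
  shows "winnable (points G l) (metric_principal_divisors G l) (D - chip (pt e c))"
proof -
  have div: "D - chip (pt e t) \<in> divisors (points G l)" if "0 \<le> t" "t \<le> l e" for t
    using D pt_in_points[OF e that] by (intro divisors_diff divisors_single)
  have lookup: "of_int (Poly_Mapping.lookup (D - chip q) p) =
      (of_int (Poly_Mapping.lookup D p) - of_bool (p = q) :: real)" for p q
    by (auto simp: lookup_minus lookup_single when_def)
  obtain f1 where f1: "regular f1" and
    "\<And>p. p \<in> points G l \<Longrightarrow> 0 \<le> of_int (Poly_Mapping.lookup (D - chip (pt e a)) p) + slope_sum f1 p"
    using wa le div[of a] by (auto simp: winnable_iff)
  then have A: "of_bool (p = pt e a) \<le> of_int (Poly_Mapping.lookup D p) + slope_sum f1 p"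
    if "p \<in> points G l" for p
    using that unfolding lookup by fastforce
  obtain f2 where f2: "regular f2" and
    "\<And>p. p \<in> points G l \<Longrightarrow> 0 \<le> of_int (Poly_Mapping.lookup (D - chip (pt e b)) p) + slope_sum f2 p"
    using wb le div[of b] by (auto simp: winnable_iff)
  then have B: "of_bool (p = pt e b) \<le> of_int (Poly_Mapping.lookup D p) + slope_sum f2 p"
    if "p \<in> points G l" for p
    using that unfolding lookup by fastforce
  define f where "f x = f2 x + - f1 x" for x
  have f: "regular f" unfolding f_def by (intro regular_add f2 regular_uminus f1)
  have slope_f: "slope_sum f p = slope_sum f2 p + - slope_sum f1 p" for p
    unfolding f_def using slope_sum_add[OF f2 regular_uminus[OF f1]] slope_sum_uminus[OF f1]
        by metis
  define \<theta> where "\<theta> = f (pt e c)"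
  define g where "g = (\<lambda>x. max (f x) \<theta>)"
  have g: "regular g" unfolding g_def by (rule regular_max_const[OF f])
  \<comment> \<open>The divisor reached by \<open>f1\<close> and then \<open>g\<close>. Where
    \<open>f \<le> \<theta>\<close> it dominates the effective divisor given by \<open>f1\<close>,
    with its chip at \<open>a\<close>; where \<open>f \<ge> \<theta>\<close> the one given by
    \<open>f2\<close>, with its chip at \<open>b\<close>.\<close>
  define T where "T p = of_int (Poly_Mapping.lookup D p) + slope_sum f1 p + slope_sum g p" for p
  have T_A: "of_bool (p = pt e a) \<le> T p" if "p \<in> points G l" "f p \<le> \<theta>" for p
    using A[OF that(1)] slope_sum_max_const(1)[OF f that] by (simp add: T_def g_def)
  have T_B: "of_bool (p = pt e b) \<le> T p" if "p \<in> points G l" "\<theta> \<le> f p" for p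
    using B[OF that(1)] slope_sum_max_const(2)[OF f that] slope_f[of p] by (simp add: T_def g_def)
  have T_nonneg: "0 \<le> T p" if "p \<in> points G l" for p
    using T_A[OF that] T_B[OF that] by (cases "f p \<le> \<theta>") (auto simp: of_bool_def split: if_splits)
  obtain r r' where r: "\<And>t. 0 \<le> t \<Longrightarrow> t < l e \<Longrightarrow> germ (\<lambda>t. f (pt e t)) t 1 (r t)"
    and r': "\<And>t. 0 < t \<Longrightarrow> t \<le> l e \<Longrightarrow> germ (\<lambda>t. f (pt e t)) t (- 1) (r' t)"
    by (rule slope_germs[OF f e]) (rule that)
  text \<open>
    At a point of the level set of \<open>\<theta>\<close> where \<open>f\<close> is not locally constant, either \<open>g\<close> has a strictly
    positive slope, or \<open>f\<close> has a negative slope sum that has to be compensated by a chip.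
  \<close>
  have T_level: "1 \<le> T (pt e t)" if t: "0 < t" "t < l e" "f (pt e t) = \<theta>" "r t \<noteq> 0 \<or> r' t \<noteq> 0" for t
  proof -
    have p: "pt e t \<in> points G l" using pt_in_points e t by simp
    have pt: "pt e t = Inr (e, t)" using t by (simp add: edge_point_def)
    have sf: "slope_sum f (pt e t) = of_int (r t + r' t)"
      using slope_eq[OF r] slope_eq[OF r'] t e by (simp add: pt slope_sum_Inr)
    have sg: "slope_sum g (pt e t) = of_int (max (r t) 0 + max (r' t) 0)"
      using slope_eq[OF germ_max_const[OF r, of t \<theta>]] slope_eq[OF germ_max_const[OF r', of t \<theta>]] t e
      by (simp add: pt slope_sum_Inr g_def)
    obtain m where m: "of_int (Poly_Mapping.lookup D (pt e t)) + slope_sum f1 (pt e t) = of_int m"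
      using slope_sum_Ints[OF f1, of "pt e t"] by (metis Ints_cases of_int_add)
    have "(0 :: real) \<le> of_int m" using A[OF p] m by (smt (verit) of_bool_def)
    then have 1: "0 \<le> m" by simp
    have "(0 :: real) \<le> of_int (m + (r t + r' t))"
      using B[OF p] m slope_f[of "pt e t"] sf by (smt (verit) of_bool_def of_int_add)
    then have 2: "0 \<le> m + (r t + r' t)" by (simp only: of_int_0_le_iff)
    have "1 \<le> m + (max (r t) 0 + max (r' t) 0)" using 1 2 t(4) by linarith
    then have "(1 :: real) \<le> of_int (m + (max (r t) 0 + max (r' t) 0))"
        by (simp only: of_int_1_le_iff)
    then show ?thesis unfolding T_def sg m by simp
  qed
  \<comment> \<open>Walk from \<open>c\<close> towards \<open>a\<close> along the level
    \<open>\<theta>\<close>. The walk stops at a nonzero slope, where \<open>T_level\<close>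
    supplies a chip, or at \<open>a\<close>, where \<open>T_A\<close> does.\<close>
  obtain a' where a': "a \<le> a'" "a' \<le> c" "1 \<le> T (pt e a')"
  proof -
    obtain h where h: "0 \<le> h" "h \<le> c - a" "f (pt e (c - h)) = \<theta>" "h = c - a \<or> r' (c - h) \<noteq> 0"
      using constant_until_nonzero_slope[of "c - a" "\<lambda>x. f (pt e (c + (-1) * x))" "\<lambda>h. r' (c - h)"
          "\<lambda>h. r (c - h)"]
        r r' le unfolding germ_shift[of "\<lambda>t. f (pt e t)"] by (auto simp: \<theta>_def)
    have "1 \<le> T (pt e (c - h))"
    proof (cases "h = c - a")
      case True
      then show ?thesis using T_A[of "pt e a"] h pt_in_points[OF e, of a] le by simp
    next
      case False
      then show ?thesis using h le by (intro T_level) auto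
    qed
    then show thesis using that[of "c - h"] h by simp
  qed
  obtain b' where b': "c \<le> b'" "b' \<le> b" "1 \<le> T (pt e b')"
  proof -
    obtain h where h: "0 \<le> h" "h \<le> b - c" "f (pt e (c + h)) = \<theta>" "h = b - c \<or> r (c + h) \<noteq> 0"
      using constant_until_nonzero_slope[of "b - c" "\<lambda>x. f (pt e (c + 1 * x))" "\<lambda>h. r (c + h)"
          "\<lambda>h. r' (c + h)"]
        r r' le unfolding germ_shift[of "\<lambda>t. f (pt e t)"] by (auto simp: \<theta>_def)
    have "1 \<le> T (pt e (c + h))"
    proof (cases "h = b - c")
      case True
      then show ?thesis using T_B[of "pt e b"] h pt_in_points[OF e, of b] le by simp
    next
      case False
      then show ?thesis using h le by (intro T_level) auto
    qed
    then show thesis using that[of "c + h"] h by simp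
  qed
  have "\<exists>w. regular w \<and> (\<forall>p\<in>points G l. of_bool (p = pt e c) \<le> T p + slope_sum w p)"
  proof (cases "a' = c \<or> b' = c")
    case True
    then have "1 \<le> T (pt e c)" using a' b' by auto
    \<comment> \<open>Nothing has to be moved; \<open>max 0 0\<close> is the zero function in the
      form required by \<open>slope_sum_max_const\<close>.\<close>
    then show ?thesis
      using T_nonneg slope_sum_max_const(1)[OF regular_const[of 0], of _ 0]
      by (intro exI[of _ "\<lambda>x. max 0 0"] conjI)
        (auto intro: regular_const add_nonneg_nonneg add_increasing2)
  next
    case False
    obtain w where w: "regular w"
      "\<And>p. p \<in> points G l \<Longrightarrow>
          of_bool (p = pt e c) - of_bool (p = pt e a') - of_bool (p = pt e b') \<le> slope_sum w p"
      by (rule fire_segment[OF e, of a' c b']) (use a' b' le False that in auto)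
    have "pt e a' \<noteq> pt e b'"
      using a' b' le False loopless by (auto simp: edge_point_def)
    then have "of_bool (p = pt e a') + of_bool (p = pt e b') \<le> T p" if "p \<in> points G l" for p
      using a' b' T_nonneg[OF that] by auto
    then show ?thesis using w by (intro exI[of _ w]) fastforce
  qed
  then obtain w where w: "regular w" "\<And>p. p \<in> points G l \<Longrightarrow>
      of_bool (p = pt e c) \<le> T p + slope_sum w p"
    by blast
  have "0 \<le> of_int (Poly_Mapping.lookup (D - chip (pt e c)) p) + slope_sum (\<lambda>x. f1 x + g x + w x) p"
    if "p \<in> points G l" for p
    using w(2)[OF that] unfolding lookup T_def by (simp add: slope_sum_add f1 g w regular_add)
  then show ?thesis
    using winnable_iff[OF div[of c]] le
        by (auto intro!: exI[of _ "\<lambda>x. f1 x + g x + w x"] regular_add f1 g w)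
qed

end


subsection \<open>The Laplacian of a loopless graph\<close>

text \<open>The discrete counterpart of \<open>slope_sum\<close>. It is minus the Laplacian, so that
  the signs agree on both sides of the comparison.\<close>

definition flow :: "('v, 'e) pre_digraph \<Rightarrow> ('v \<Rightarrow> int) \<Rightarrow> 'v \<Rightarrow> int" where
  "flow H x u = (\<Sum>a | a \<in> arcs H \<and> tail H a = u. x (head H a) - x u) +
     (\<Sum>a | a \<in> arcs H \<and> head H a = u. x (tail H a) - x u)"

lemma laplacian_eq_flow:
  assumes "fin_digraph H" "loopfree_digraph H" "u \<in> verts H"
  shows "(\<Sum>v\<in>verts H. laplacian H u v * x v) = - flow H x u"
proof -
  interpret fin_digraph H by (rule assms(1))
  interpret loopfree_digraph H by (rule assms(2))
  define outs where "outs = {a \<in> arcs H. tail H a = u}"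
  define ins where "ins = {a \<in> arcs H. head H a = u}"
  have fin: "finite outs" "finite ins" by (auto simp: outs_def ins_def)
  \<comment> \<open>Without loops no arc is incident in both ways, so the counts of arcs add
    up.\<close>
  have disj: "outs \<inter> ins = {}" using no_loops by (fastforce simp: outs_def ins_def)
  have "{a \<in> arcs H. tail H a = u \<or> head H a = u} = outs \<union> ins" by (auto simp: outs_def ins_def)
  then have diag: "laplacian H u u = int (card outs) + int (card ins)"
    using fin disj by (simp add: laplacian_def card_Un_disjoint)
  have off: "laplacian H u v = - int (card {a \<in> outs. head H a = v}) - int (card {a \<in> ins. tail H a = v})"
    if "v \<noteq> u" for v
  proof -
    have "{a \<in> arcs H. {tail H a, head H a} = {u, v}} =
        {a \<in> outs. head H a = v} \<union> {a \<in> ins. tail H a = v}"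
      using that by (auto simp: outs_def ins_def doubleton_eq_iff)
    moreover have "{a \<in> outs. head H a = v} \<inter> {a \<in> ins. tail H a = v} = {}" using disj by auto
    ultimately show ?thesis using that fin by (simp add: laplacian_def card_Un_disjoint)
  qed
  have out: "(\<Sum>v\<in>verts H - {u}. int (card {a \<in> outs. head H a = v}) * x v) = (\<Sum>a\<in>outs. x (head H a))"
  proof -
    have "(\<Sum>v\<in>verts H - {u}. int (card {a \<in> outs. head H a = v}) * x v) =
        (\<Sum>v\<in>verts H - {u}. \<Sum>a\<in>{a \<in> outs. head H a = v}. x (head H a))"
      by (intro sum.cong) auto
    also have "\<dots> = (\<Sum>a\<in>outs. x (head H a))"
      using fin no_loops by (intro sum.group) (fastforce simp: outs_def)+
    finally show ?thesis .
  qed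
  have inn: "(\<Sum>v\<in>verts H - {u}. int (card {a \<in> ins. tail H a = v}) * x v) = (\<Sum>a\<in>ins. x (tail H a))"
  proof -
    have "(\<Sum>v\<in>verts H - {u}. int (card {a \<in> ins. tail H a = v}) * x v) =
        (\<Sum>v\<in>verts H - {u}. \<Sum>a\<in>{a \<in> ins. tail H a = v}. x (tail H a))"
      by (intro sum.cong) auto
    also have "\<dots> = (\<Sum>a\<in>ins. x (tail H a))"
      using fin no_loops by (intro sum.group) (fastforce simp: ins_def)+
    finally show ?thesis .
  qed
  have "(\<Sum>v\<in>verts H. laplacian H u v * x v) =
      laplacian H u u * x u + (\<Sum>v\<in>verts H - {u}. laplacian H u v * x v)"
    using assms(3) by (simp add: sum.remove)
  also have "(\<Sum>v\<in>verts H - {u}. laplacian H u v * x v) =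
      (\<Sum>v\<in>verts H - {u}. - (int (card {a \<in> outs. head H a = v}) * x v) - int (card {a \<in> ins. tail H a = v}) * x v)"
    by (intro sum.cong) (auto simp: off algebra_simps)
  also have "\<dots> = - (\<Sum>a\<in>outs. x (head H a)) - (\<Sum>a\<in>ins. x (tail H a))"
    unfolding sum_subtractf sum_negf out inn ..
  finally show ?thesis
    unfolding flow_def outs_def[symmetric] ins_def[symmetric] diag
    by (simp add: sum_subtractf algebra_simps)
qed

lemma winnable_graph_iff:
  assumes "fin_digraph H" "loopfree_digraph H" "D \<in> divisors (verts H)"
  shows "winnable (verts H) (principal_divisors H) D \<longleftrightarrow>
    (\<exists>x. \<forall>u\<in>verts H. 0 \<le> Poly_Mapping.lookup D u + flow H x u)"
proof
  assume "winnable (verts H) (principal_divisors H) D"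
  then obtain F x where F: "effective F"
    "\<And>u. u \<in> verts H \<Longrightarrow> Poly_Mapping.lookup (D - F) u = - flow H x u"
    by (auto simp: winnable_def equivalent_def principal_divisors_def laplacian_eq_flow[OF assms(1,2)])
  then have "0 \<le> Poly_Mapping.lookup D u + flow H x u" if "u \<in> verts H" for u
  proof -
    have "Poly_Mapping.lookup D u - Poly_Mapping.lookup F u = - flow H x u"
      using F(2)[OF that] by (simp add: lookup_minus)
    moreover have "0 \<le> Poly_Mapping.lookup F u" using F(1) by (simp add: effective_def)
    ultimately show ?thesis by linarith
  qed
  then show "\<exists>x. \<forall>u\<in>verts H. 0 \<le> Poly_Mapping.lookup D u + flow H x u" by blast
next
  assume "\<exists>x. \<forall>u\<in>verts H. 0 \<le> Poly_Mapping.lookup D u + flow H x u"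
  then obtain x where x: "\<And>u. u \<in> verts H \<Longrightarrow> 0 \<le> Poly_Mapping.lookup D u + flow H x u" by blast
  define h where "h u = (if u \<in> verts H then Poly_Mapping.lookup D u + flow H x u else 0)" for u
  have "finite {u. h u \<noteq> 0}"
    using fin_digraph.finite_verts[OF assms(1)] by (rule finite_subset[rotated]) (auto simp: h_def)
  then have lookup: "Poly_Mapping.lookup (Abs_poly_mapping h) = h" by (rule lookup_Abs_poly_mapping)
  define F where "F = Abs_poly_mapping h"
  have F: "F \<in> divisors (verts H)" by (rule divisorsI) (simp add: F_def lookup h_def)
  have "effective F" using x by (auto simp: F_def effective_def lookup h_def)
  moreover have "D - F \<in> principal_divisors H"
    unfolding principal_divisors_def
    using F assms(3)
    by (auto simp: divisors_diff laplacian_eq_flow[OF assms(1,2)] lookup_minus F_def lookup h_def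
        intro!: exI[of _ x])
  ultimately show "winnable (verts H) (principal_divisors H) D"
    using F by (auto simp: winnable_def equivalent_def)
qed


subsection \<open>Subdivisions inside the metric graph\<close>

locale loopfree_unit_metric_graph = metric_graph G "\<lambda>_. 1" + loopfree_digraph G
  for G :: "('a, 'b) pre_digraph"
begin

text \<open>The one-chip condition of \<open>rank_ge_of_subset\<close> for the vertices of
  \<open>G\<close>: an interior point lies between the ends of its edge.\<close>

lemma winnable_of_vertices:
  assumes D: "D \<in> divisors (points G (\<lambda>_. 1))" and p: "p \<in> points G (\<lambda>_. 1)"
    and v: "\<And>a. a \<in> Inl ` verts G \<Longrightarrow>
      winnable (points G (\<lambda>_. 1)) (metric_principal_divisors G (\<lambda>_. 1)) (D - chip a)"
  shows "winnable (points G (\<lambda>_. 1)) (metric_principal_divisors G (\<lambda>_. 1)) (D - chip p)"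
  using p
proof (cases p rule: points_cases)
  case (vertex u)
  then show ?thesis using v by simp
next
  case (interior e t)
  have "winnable (points G (\<lambda>_. 1)) (metric_principal_divisors G (\<lambda>_. 1)) (D - chip (pt e t))"
    by (rule winnable_between[of e D 0 t 1]) (use interior D v no_loops in \<open>auto simp: edge_point_def\<close>)
  then show ?thesis using interior by (simp add: edge_point_def)
qed

end

locale subdivided_graph = loopfree_unit_metric_graph +
  fixes k :: nat
  assumes k: "0 < k"
begin

abbreviation H :: "('a + 'b \<times> nat, 'b \<times> nat) pre_digraph" where
  "H \<equiv> subdivide_edges k G"

abbreviation sv :: "'b \<Rightarrow> nat \<Rightarrow> 'a + 'b \<times> nat" where
  "sv \<equiv> subdivision_vertex k G"

abbreviation P :: "('a, 'b) mpoint set" where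
  "P \<equiv> points G (\<lambda>_. 1)"

abbreviation Prin :: "('a, 'b) mpoint divisor set" where
  "Prin \<equiv> metric_principal_divisors G (\<lambda>_. 1)"

definition embed :: "'a + 'b \<times> nat \<Rightarrow> ('a, 'b) mpoint" where
  "embed = map_sum id (\<lambda>(e, i). (e, real i / real k))"

lemma embed_simps [simp]: "embed (Inl v) = Inl v" "embed (Inr (e, i)) = Inr (e, real i / real k)"
  by (simp_all add: embed_def)

lemma inj_embed: "inj embed"
  using k by (auto simp: inj_def embed_def map_sum_def split: sum.splits prod.splits)

lemma H_simps:
  "arcs H = arcs G \<times> {..<k}" "tail H (e, i) = sv e i" "head H (e, i) = sv e (Suc i)"
  "verts H = Inl ` verts G \<union> {Inr (e, i) | e i. e \<in> arcs G \<and> 0 < i \<and> i < k}"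
  by (simp_all add: subdivide_edges_def)

lemma sv_in_verts: "e \<in> arcs G \<Longrightarrow> i \<le> k \<Longrightarrow> sv e i \<in> verts H"
  using k by (auto simp: H_simps subdivision_vertex_def)

lemma embed_sv: "embed (sv e i) = pt e (real i / real k)"
proof (cases "i = k")
  case True
  show ?thesis unfolding True using k by (simp add: subdivision_vertex_def edge_point_def)
next
  case False
  then show ?thesis using k by (simp add: subdivision_vertex_def edge_point_def)
qed

lemma embed_in_points: "u \<in> verts H \<Longrightarrow> embed u \<in> P"
  using k by (auto simp: H_simps points_def)

lemma verts_H_cases [consumes 1, case_names vertex interior]:
  assumes "u \<in> verts H"
  obtains v where "u = Inl v" "v \<in> verts G"
    | e i where "u = Inr (e, i)" "e \<in> arcs G" "0 < i" "i < k"
  using assms by (auto simp: H_simps)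

lemma fin_H: "fin_digraph H"
proof
  have "{Inr (e, i) | e i. e \<in> arcs G \<and> 0 < i \<and> i < k} \<subseteq> Inr ` (arcs G \<times> {..<k})" by auto
  then have "finite {Inr (e, i) :: 'a + 'b \<times> nat | e i. e \<in> arcs G \<and> 0 < i \<and> i < k}"
    by (rule finite_subset) auto
  then show "finite (verts H)" by (simp add: H_simps)
qed (auto simp: H_simps(1-3) intro!: sv_in_verts)

lemma loopfree_H: "loopfree_digraph H"
proof -
  interpret H: fin_digraph H by (rule fin_H)
  show ?thesis
    by unfold_locales (use no_loops in \<open>auto simp: H_simps subdivision_vertex_def split: if_splits\<close>)
qed

lemma flow_Inl:
  "flow H x (Inl v) = (\<Sum>e | e \<in> arcs G \<and> tail G e = v. x (sv e 1) - x (sv e 0)) +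
     (\<Sum>e | e \<in> arcs G \<and> head G e = v. x (sv e (k - 1)) - x (sv e k))"
proof -
  have "{a. a \<in> arcs H \<and> tail H a = Inl v} = (\<lambda>e. (e, 0)) ` {e. e \<in> arcs G \<and> tail G e = v}"
    using k by (auto simp: H_simps subdivision_vertex_def split: if_splits)
  moreover have "{a. a \<in> arcs H \<and> head H a = Inl v} = (\<lambda>e. (e, k - 1)) ` {e. e \<in> arcs G \<and>
      head G e = v}"
    using k by (auto simp: H_simps subdivision_vertex_def split: if_splits)
  ultimately show ?thesis
    using k unfolding flow_def
    by (simp add: sum.reindex inj_on_def H_simps) (simp add: subdivision_vertex_def)
qed

lemma flow_Inr:
  assumes "e \<in> arcs G" "0 < i" "i < k"
  shows "flow H x (Inr (e, i)) = (x (sv e (i + 1)) - x (sv e i)) + (x (sv e (i - 1)) - x (sv e i))"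
proof -
  have "{a. a \<in> arcs H \<and> tail H a = Inr (e, i)} = {(e, i)}"
    using assms by (auto simp: H_simps subdivision_vertex_def split: if_splits)
  moreover have "{a. a \<in> arcs H \<and> head H a = Inr (e, i)} = {(e, i - 1)}"
    using assms by (auto simp: H_simps subdivision_vertex_def split: if_splits)
  ultimately show ?thesis
    using assms unfolding flow_def by (simp add: H_simps) (simp add: subdivision_vertex_def)
qed

lemma lookup_push_embed: "Poly_Mapping.lookup (push_divisor embed D) (embed u) = Poly_Mapping.lookup D u"
  by (rule lookup_push_divisor_inj[OF inj_embed]) auto

lemma lookup_push_embed_notin:
  "p \<notin> embed ` verts H \<Longrightarrow> D \<in> divisors (verts H) \<Longrightarrow> Poly_Mapping.lookup (push_divisor embed D) p = 0"
  by (rule lookup_push_divisor_notin) (auto simp: divisors_def)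

lemma push_embed_in_divisors: "D \<in> divisors (verts H) \<Longrightarrow> push_divisor embed D \<in> divisors P"
  by (rule push_divisor_in_divisors) (auto intro: embed_in_points)

text \<open>
  The witness is interpolated linearly and divided by \<open>k\<close>, so that its differences become slopes on
  edges of length \<open>1 / k\<close>.
\<close>

lemma winnable_push_embed:
  assumes D: "D \<in> divisors (verts H)" and "winnable (verts H) (principal_divisors H) D"
  shows "winnable P Prin (push_divisor embed D)"
proof -
  obtain x where x: "\<And>u. u \<in> verts H \<Longrightarrow> 0 \<le> Poly_Mapping.lookup D u + flow H x u"
    using assms winnable_graph_iff[OF fin_H loopfree_H D] by blast
  define X where "X e j = x (sv e j)" for e j
  define m where "m e j = X e (Suc j) - X e j" for e j
  define f :: "('a, 'b) mpoint \<Rightarrow> real" where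
    "f = case_sum (\<lambda>v. of_int (x (Inl v)) / k)
      (\<lambda>(e, t). let j = nat \<lfloor>k * t\<rfloor> in (of_int (X e j) + of_int (m e j) * (k * t - j)) / k)"
  have grid: "f (pt e (real j / k)) = of_int (X e j) / k" for e j
    using k by (auto simp: f_def edge_point_def X_def subdivision_vertex_def)
  have lin: "f (pt e t) = f (pt e (real j / k)) + of_int (m e j) * (t - real j / k)"
    if "j < k" "real j / k \<le> t" "t \<le> real (Suc j) / k" for e j t
  proof (cases "t = real j / k \<or> t = real (Suc j) / k")
    case True
    then show ?thesis
    proof
      assume t: "t = real (Suc j) / k"
      show ?thesis unfolding t grid m_def using k by (simp add: field_simps)
    qed simp
  next
    case False
    then have t: "real j / k < t" "t < real (Suc j) / k" using that by auto
    then have "\<lfloor>k * t\<rfloor> = int j" using k by (intro floor_unique) (auto simp: field_simps)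
    moreover have "real (Suc j) / k \<le> 1" using that k by simp
    then have "pt e t = Inr (e, t)" using t
        by (auto simp: edge_point_def) (smt (verit) divide_nonneg_nonneg of_nat_0_le_iff)
    ultimately show ?thesis using grid[of e j] k by (simp add: f_def field_simps)
  qed
  have right: "germ (\<lambda>t. f (pt e t)) t 1 (m e j)"
    if "j < k" "real j / k \<le> t" "t < real (Suc j) / k" for e j t
    by (rule germ_linear_right[OF lin]) (use that in auto)
  have left: "germ (\<lambda>t. f (pt e t)) t (-1) (- m e j)"
    if "j < k" "real j / k < t" "t \<le> real (Suc j) / k" for e j t
    by (rule germ_linear_left[OF lin]) (use that in auto)
  have ex_right: "\<exists>j<k. real j / k \<le> t \<and> t < real (Suc j) / k" if "0 \<le> t" "t < 1" for t
  proof (intro exI conjI)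
    have "0 \<le> k * t" "k * t < k" using that k by auto
    then show "nat \<lfloor>k * t\<rfloor> < k" by (simp add: floor_less_iff nat_less_iff)
    show "real (nat \<lfloor>k * t\<rfloor>) / k \<le> t" "t < real (Suc (nat \<lfloor>k * t\<rfloor>)) / k"
      using \<open>0 \<le> k * t\<close> k by (auto simp: field_simps) linarith+
  qed
  \<comment> \<open>A left germ needs room on the left, so here a grid point belongs to the cell
    before it.\<close>
  have ex_left: "\<exists>j<k. real j / k < t \<and> t \<le> real (Suc j) / k" if t: "0 < t" "t \<le> 1" for t
  proof (cases "t = 1")
    case True
    then show ?thesis using k by (intro exI[of _ "k - 1"]) (auto simp: field_simps)
  next
    case False
    then obtain j where j: "j < k" "real j / k \<le> t" "t < real (Suc j) / k"
      using ex_right[of t] t by auto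
    show ?thesis
    proof (cases "real j / k = t")
      case True
      then have "0 < j" using t by (cases j) auto
      then show ?thesis using True j k by (intro exI[of _ "j - 1"]) (auto simp: field_simps)
    next
      case False
      then show ?thesis using j by (intro exI[of _ j]) auto
    qed
  qed
  have reg: "regular f"
    unfolding regular_def has_germs_def using ex_right ex_left left right by metis
  have slope_right: "slope (\<lambda>t. f (pt e t)) (real j / k) 1 = of_int (X e (Suc j) - X e j)"
      if "j < k" for e j
    using slope_eq[OF right[OF that, of "real j / k" e]] k
        by (simp add: m_def divide_strict_right_mono)
  have slope_left: "slope (\<lambda>t. f (pt e t)) (real j / k) (-1) = of_int (X e (j - 1) - X e j)"
      if "0 < j" "j \<le> k" for e j
    using slope_eq[OF left[of "j - 1" "real j / k" e]] that k
        by (simp add: m_def divide_strict_right_mono of_nat_diff)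
  have emb: "slope_sum f (embed u) = of_int (flow H x u)" if "u \<in> verts H" for u
    using that
  proof (cases u rule: verts_H_cases)
    case (vertex v)
    then show ?thesis
      using slope_right[of 0] slope_left[of k] k
      by (simp add: slope_sum_Inl flow_Inl X_def)
  next
    case (interior e i)
    then show ?thesis
      using slope_right[of i e] slope_left[of i e] k
      by (simp add: slope_sum_Inr flow_Inr X_def)
  qed
  \<comment> \<open>Off the grid the point is interior to a linear piece, whose two slopes
    cancel.\<close>
  have rest: "0 \<le> slope_sum f p" if p: "p \<in> P" "p \<notin> embed ` verts H" for p
    using p(1)
  proof (cases p rule: points_cases)
    case (vertex v)
    then have "p = embed (Inl v)" "Inl v \<in> verts H" by (auto simp: H_simps)
    then show ?thesis using p(2) by blast
  next
    case (interior e t)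
    then obtain j where j: "j < k" "real j / k \<le> t" "t < real (Suc j) / k" using ex_right[of t]
        by auto
    have "real j / k \<noteq> t"
    proof
      assume "real j / k = t"
      then have "p = embed (Inr (e, j))" "Inr (e, j) \<in> verts H"
        using interior j(1) by (auto simp: H_simps intro: Nat.gr0I)
      then show False using p(2) by blast
    qed
    then show ?thesis
      using j interior slope_eq[OF right[of j t e]] slope_eq[OF left[of j t e]]
      by (simp add: slope_sum_Inr)
  qed
  have "0 \<le> of_int (Poly_Mapping.lookup (push_divisor embed D) p)
      + slope_sum f p" if p: "p \<in> P" for p
  proof (cases "p \<in> embed ` verts H")
    case True
    then obtain u where u: "u \<in> verts H" "p = embed u" by auto
    have "(0 :: real) \<le> of_int (Poly_Mapping.lookup D u + flow H x u)" using x[OF u(1)]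
        by (simp only: of_int_0_le_iff)
    then show ?thesis using u by (simp add: lookup_push_embed emb)
  next
    case False
    then show ?thesis using rest[OF p False] lookup_push_embed_notin[OF False D] by simp
  qed
  then show ?thesis using winnable_iff[OF push_embed_in_divisors[OF D]] reg by blast
qed

text \<open>
  Where the divisor has no chips, the function is convex, so its slopes at a vertex are bounded by
  the difference quotients along the incident edges. Since slopes are integers, this survives
  rounding all values down to integers.
\<close>

lemma winnable_of_push_embed:
  assumes D: "D \<in> divisors (verts H)" and "winnable P Prin (push_divisor embed D)"
  shows "winnable (verts H) (principal_divisors H) D"
proof -
  obtain f where f: "regular f"
    "\<And>p. p \<in> P \<Longrightarrow> 0 \<le> of_int (Poly_Mapping.lookup (push_divisor embed D) p) + slope_sum f p"
    using assms winnable_iff[OF push_embed_in_divisors[OF D]] by blast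
  define x where "x u = \<lfloor>k * f (embed u)\<rfloor>" for u
  have x_sv: "x (sv e j) = \<lfloor>k * f (pt e (real j / k))\<rfloor>" for e j
    by (simp add: x_def embed_sv)
  \<comment> \<open>Adding an integer commutes with the floor, so an integer lower bound for a
    difference survives rounding both terms down.\<close>
  have round: "m \<le> \<lfloor>b\<rfloor> - \<lfloor>a\<rfloor>" if "of_int m \<le> b - a" for m :: int and a b :: real
    using that by linarith
  have slopes: "slope (\<lambda>t. f (pt e t)) (real j / k) 1 \<le> of_int (x (sv e (Suc j)) - x (sv e j)) \<and>
      slope (\<lambda>t. f (pt e t)) (real (Suc j) / k) (-1) \<le> of_int (x (sv e j) - x (sv e (Suc j)))"
    if e: "e \<in> arcs G" and j: "j < k" for e j
  proof -
    define a where "a = real j / k"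
    define b where "b = real (Suc j) / k"
    have ab: "0 \<le> a" "a < b" "b \<le> 1" "b - a = 1 / k"
      using j k by (auto simp: a_def b_def field_simps)
    obtain r r' where r: "\<And>t. 0 \<le> t \<Longrightarrow> t < 1 \<Longrightarrow> germ (\<lambda>t. f (pt e t)) t 1 (r t)"
      and r': "\<And>t. 0 < t \<Longrightarrow> t \<le> 1 \<Longrightarrow> germ (\<lambda>t. f (pt e t)) t (- 1) (r' t)"
      by (rule slope_germs[OF f(1) e]) (rule that)
    have convex: "0 \<le> r t + r' t" if t: "a < t" "t < b" for t
    proof -
      have t': "0 < t" "t < 1" using t ab by auto
      have "Inr (e, t) \<notin> embed ` verts H"
      proof
        assume "Inr (e, t) \<in> embed ` verts H"
        then obtain i :: nat where "t = real i / k" by (auto simp: H_simps)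
        then have "real j < real i" "real i < real (Suc j)" using t k
            by (auto simp: a_def b_def field_simps)
        then have "j < i" "i < Suc j" by (simp_all only: of_nat_less_iff)
        then show False by linarith
      qed
      moreover have "Inr (e, t) \<in> P" using e t' by (auto simp: points_def)
      ultimately have "0 \<le> slope_sum f (Inr (e, t))"
        using f(2)[of "Inr (e, t)"] lookup_push_embed_notin[OF _ D] by simp
      also have "\<dots> = of_int (r t + r' t)"
        using slope_eq[OF r] slope_eq[OF r'] t' e by (simp add: slope_sum_Inr)
      finally show ?thesis by (simp only: of_int_0_le_iff)
    qed
    have "of_int (r a) * (b - a) \<le> f (pt e b) - f (pt e a)"
      using convex_above_tangent[of "b - a" "\<lambda>h. f (pt e (a + 1 * h))" "\<lambda>h. r (a + h)"
          "\<lambda>h. r' (a + h)"]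
        r r' ab(1-3) convex unfolding germ_shift[of "\<lambda>t. f (pt e t)"] by simp
    then have "r a \<le> \<lfloor>k * f (pt e b)\<rfloor> - \<lfloor>k * f (pt e a)\<rfloor>"
      using k ab(4) by (intro round) (simp add: field_simps)
    \<comment> \<open>The same estimate along the reversed segment.\<close>
    moreover have "of_int (r' b) * (b - a) \<le> f (pt e a) - f (pt e b)"
      using convex_above_tangent[of "b - a" "\<lambda>h. f (pt e (b + (-1) * h))" "\<lambda>h. r' (b - h)"
          "\<lambda>h. r (b - h)"]
        r r' ab(1-3) convex unfolding germ_shift[of "\<lambda>t. f (pt e t)"] by (simp add: add.commute)
    then have "r' b \<le> \<lfloor>k * f (pt e a)\<rfloor> - \<lfloor>k * f (pt e b)\<rfloor>"
      using k ab(4) by (intro round) (simp add: field_simps)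
    ultimately show ?thesis
      using slope_eq[OF r[of a]] slope_eq[OF r'[of b]] ab
      unfolding x_sv a_def[symmetric] b_def[symmetric] by simp
  qed
  have le: "slope_sum f (embed u) \<le> of_int (flow H x u)" if "u \<in> verts H" for u
    using that
  proof (cases u rule: verts_H_cases)
    case (vertex v)
    have "slope (\<lambda>t. f (pt e t)) 0 1 \<le> of_int (x (sv e 1) - x (sv e 0))" if "e \<in> arcs G" for e
      using slopes[OF that, of 0] k by simp
    moreover have "slope (\<lambda>t. f (pt e t)) 1 (-1) \<le> of_int (x (sv e (k - 1)) - x (sv e k))"
        if "e \<in> arcs G" for e
      using slopes[OF that, of "k - 1"] k by simp
    ultimately show ?thesis
      unfolding vertex embed_simps slope_sum_Inl flow_Inl of_int_add of_int_sum
      by (intro add_mono sum_mono) auto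
  next
    case (interior e i)
    then have "i - 1 < k" "Suc (i - 1) = i" by auto
    then show ?thesis
      using interior slopes[of e i] slopes[of e "i - 1"] by (simp add: slope_sum_Inr flow_Inr)
  qed
  have "0 \<le> Poly_Mapping.lookup D u + flow H x u" if "u \<in> verts H" for u
  proof -
    have "(0 :: real) \<le> of_int (Poly_Mapping.lookup D u + flow H x u)"
      using f(2)[OF embed_in_points[OF that]] le[OF that] by (simp add: lookup_push_embed)
    then show ?thesis by (simp only: of_int_0_le_iff)
  qed
  then show ?thesis using winnable_graph_iff[OF fin_H loopfree_H D] by blast
qed

text \<open>The analogue of \<open>winnable_of_vertices\<close> with the point between two
  neighbouring grid points.\<close>

lemma winnable_of_grid:
  assumes D: "D \<in> divisors P" and p: "p \<in> P"
    and v: "\<And>a. a \<in> embed ` verts H \<Longrightarrow> winnable P Prin (D - chip a)"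
  shows "winnable P Prin (D - chip p)"
  using p
proof (cases p rule: points_cases)
  case (vertex u)
  then have "p = embed (Inl u)" "Inl u \<in> verts H" by (auto simp: H_simps)
  then show ?thesis using v by blast
next
  case (interior e t)
  have pt: "p = pt e t" using interior by (simp add: edge_point_def)
  define j where "j = nat \<lfloor>k * t\<rfloor>"
  have "0 \<le> k * t" "k * t < k" using interior k by auto
  then have "j < k" unfolding j_def by (simp add: floor_less_iff nat_less_iff)
  have "real j \<le> k * t" "k * t < real (Suc j)" using \<open>0 \<le> k * t\<close> by (auto simp: j_def) linarith
  then have j: "real j / k \<le> t" "t < real (Suc j) / k" using k by (auto simp: field_simps)
  have w: "winnable P Prin (D - chip (pt e (real i / k)))" if "i \<le> k" for i
    using v sv_in_verts[OF interior(2) that] by (simp flip: embed_sv)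
  show ?thesis
  proof (cases "real j / k = t")
    case True
    then show ?thesis using w[of j] \<open>j < k\<close> pt by simp
  next
    case False
    show ?thesis
      unfolding pt
      by (rule winnable_between[OF no_loops D _ _ _ _ _ w[of j] w[of "Suc j"]])
        (use interior j False \<open>j < k\<close> k in auto)
  qed
qed

text \<open>Degree 0 is inherited from the metric graph: a principal divisor is winnable, so its
  push-forward has nonnegative degree, and the same holds for its negative.\<close>

sublocale H: divisor_theory "verts H" "principal_divisors H"
proof
  obtain p where "p \<in> P" using nonempty by blast
  then have "verts G \<noteq> {}" by (cases p rule: points_cases) (auto dest: tail_in_verts)
  then show "verts H \<noteq> {}" by (simp add: H_simps)
  have *: "0 \<le> div_degree D" if "D \<in> principal_divisors H" for D
  proof -
    have "winnable (verts H) (principal_divisors H) D"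
      using that by (auto simp: winnable_def equivalent_def effective_def intro!: bexI[of _ 0])
    then have "winnable P Prin (push_divisor embed D)"
      using that by (intro winnable_push_embed) (auto simp: principal_divisors_def)
    then show ?thesis using winnable_degree by fastforce
  qed
  fix D assume D: "D \<in> principal_divisors H"
  then have "- D \<in> principal_divisors H"
  proof -
    obtain x where "\<forall>u\<in>verts H. Poly_Mapping.lookup D u = (\<Sum>v\<in>verts H. laplacian H u v * x v)"
      using D by (auto simp: principal_divisors_def)
    then have "\<forall>u\<in>verts H. Poly_Mapping.lookup (- D) u = (\<Sum>v\<in>verts H. laplacian H u v * - x v)"
      by (simp add: sum_negf)
    moreover have "- D \<in> divisors (verts H)" using D
        by (auto simp: principal_divisors_def divisors_def)
    ultimately show ?thesis
      unfolding principal_divisors_def by (intro CollectI conjI exI[of _ "\<lambda>v. - x v"])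
  qed
  from *[OF this] *[OF D] show "div_degree D = 0" by (simp add: div_degree_uminus)
qed

text \<open>From \<open>P\<close> to the graph one merely tests with fewer divisors. The converse
  needs that the grid is rank-determining.\<close>

lemma rank_ge_push_embed_iff:
  assumes D: "D \<in> divisors (verts H)"
  shows "rank_ge P Prin (push_divisor embed D) r \<longleftrightarrow> rank_ge (verts H) (principal_divisors H) D r"
proof
  assume *: "rank_ge P Prin (push_divisor embed D) r"
  show "rank_ge (verts H) (principal_divisors H) D r"
    unfolding rank_ge_def
  proof (intro ballI impI)
    fix E assume E: "E \<in> divisors (verts H)" "effective E \<and> div_degree E = r"
    then have "winnable P Prin (push_divisor embed (D - E))"
      using * push_embed_in_divisors[OF E(1)] unfolding rank_ge_def push_divisor_diff
      by (simp add: effective_push_divisor)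
    then show "winnable (verts H) (principal_divisors H) (D - E)"
      using D E by (intro winnable_of_push_embed divisors_diff)
  qed
next
  assume *: "rank_ge (verts H) (principal_divisors H) D r"
  show "rank_ge P Prin (push_divisor embed D) r"
  proof (rule rank_ge_of_subset[where A = "embed ` verts H"])
    show "embed ` verts H \<subseteq> P" using embed_in_points by auto
    show "push_divisor embed D \<in> divisors P" by (rule push_embed_in_divisors[OF D])
    fix E assume E: "E \<in> divisors (embed ` verts H)" "effective E" "div_degree E = r"
    \<comment> \<open>The pullback along the injective \<open>embed\<close>; since \<open>E\<close>
      is supported on the grid, pushing it forward again restores \<open>E\<close>.\<close>
    define E' where "E' = Poly_Mapping.map_key embed E"
    have lookup: "Poly_Mapping.lookup E' u = Poly_Mapping.lookup E (embed u)" for u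
      unfolding E'_def by (simp add: map_key.rep_eq[OF inj_embed])
    have "push_divisor embed E' = E"
    proof (rule poly_mapping_eqI)
      fix p
      show "Poly_Mapping.lookup (push_divisor embed E') p = Poly_Mapping.lookup E p"
      proof (cases "p \<in> range embed")
        case True
        then show ?thesis by (auto simp: lookup_push_embed lookup)
      next
        case False
        then have "p \<notin> embed ` A" for A by auto
        then show ?thesis using divisors_lookup_eq_0[OF E(1)]
            by (simp add: lookup_push_divisor_notin)
      qed
    qed
    moreover have E': "E' \<in> divisors (verts H)"
      using divisors_lookup_eq_0[OF E(1)] inj_embed
      by (intro divisorsI) (simp add: lookup inj_image_mem_iff)
    moreover have "effective E'" using E(2) by (simp add: effective_def lookup)
    moreover have "div_degree E' = r" using E(3) calculation(1) div_degree_push_divisor by metis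
    ultimately show "winnable P Prin (push_divisor embed D - E)"
      using * winnable_push_embed[of "D - E'"] D unfolding rank_ge_def
      by (simp add: divisors_diff push_divisor_diff)
  qed (rule winnable_of_grid)
qed

lemma ex_rank_ge:
  assumes "0 \<le> r"
  shows "\<exists>D \<in> divisors (verts H). rank_ge (verts H) (principal_divisors H) D r"
proof -
  \<comment> \<open>With \<open>r\<close> chips on every vertex, subtracting any effective divisor
    of degree \<open>r\<close> leaves an effective one.\<close>
  define h where "h u = (if u \<in> verts H then r else 0)" for u
  have "finite {u. h u \<noteq> 0}"
    using fin_digraph.finite_verts[OF fin_H] by (rule finite_subset[rotated]) (auto simp: h_def)
  then have lookup: "Poly_Mapping.lookup (Abs_poly_mapping h) = h" by (rule lookup_Abs_poly_mapping)
  define D where "D = Abs_poly_mapping h"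
  have D: "D \<in> divisors (verts H)" by (rule divisorsI) (simp add: D_def lookup h_def)
  have "winnable (verts H) (principal_divisors H) (D - E)"
    if E: "E \<in> divisors (verts H)" "effective E" "div_degree E = r" for E
  proof -
    have "effective (D - E)"
      unfolding effective_def
    proof
      fix u
      show "0 \<le> Poly_Mapping.lookup (D - E) u"
        using lookup_le_degree[OF E(2), of u] E(3) divisors_lookup_eq_0[OF E(1), of u]
        by (simp add: lookup_minus D_def lookup h_def)
    qed
    moreover have "0 \<in> principal_divisors H"
      by (auto simp: principal_divisors_def intro!: exI[of _ "\<lambda>_. 0"])
    ultimately show ?thesis
      using D E(1) by (auto simp: winnable_def equivalent_def intro!: bexI[of _ "D - E"]
          divisors_diff)
  qed
  then show ?thesis using D unfolding rank_ge_def by blast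
qed

end


subsection \<open>Simultaneous rounding\<close>

lemma simultaneous_rounding:
  fixes X :: "real set"
  assumes "finite X" "0 < \<epsilon>"
  obtains k :: nat where "0 < k" "\<And>x. x \<in> X \<Longrightarrow> \<bar>of_int (round (real k * x)) - real k * x\<bar> < \<epsilon>"
proof -
  obtain \<theta> where \<theta>: "bij_betw \<theta> {0..<card X} X" using ex_bij_betw_nat_finite[OF assms(1)] by blast
  obtain N0 :: nat where N0: "1 / \<epsilon> < real N0" using reals_Archimedean2 by blast
  \<comment> \<open>\<open>1 / N \<le> \<epsilon>\<close> gives the accuracy;
    \<open>2 \<le> N\<close> makes the integer from Dirichlet's theorem the nearest one, hence the
    value of \<open>round\<close>.\<close>
  define N where "N = N0 + 2"
  have "1 / \<epsilon> < real N" "2 \<le> real N" using N0 by (auto simp: N_def)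
  then have N: "0 < N" "1 / real N \<le> \<epsilon>" "1 / real N \<le> 1 / 2"
    using assms(2) by (auto simp: field_simps)
  obtain q p where q: "0 < q" "\<And>i. i < card X \<Longrightarrow> \<bar>of_int q * \<theta> i - of_int (p i)\<bar> < 1 / real N"
    using Dirichlet_approx_simult[OF N(1), of "card X" \<theta>] by blast
  show thesis
  proof (rule that[of "nat q"])
    show "0 < nat q" using q(1) by simp
    fix x assume "x \<in> X"
    then obtain i where i: "i < card X" "x = \<theta> i" using \<theta> unfolding bij_betw_def
        by (metis atLeastLessThan_iff imageE)
    have *: "\<bar>real (nat q) * x - of_int (p i)\<bar> < 1 / real N" using q i by simp
    then have "round (real (nat q) * x) = p i"
      using N(3) by (intro round_unique') linarith
    then show "\<bar>of_int (round (real (nat q) * x)) - real (nat q) * x\<bar> < \<epsilon>"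
      using * N(2) by (simp add: abs_minus_commute)
  qed
qed

definition consecutive :: "real set \<Rightarrow> real \<Rightarrow> real \<Rightarrow> bool" where
  "consecutive S s s' \<longleftrightarrow> s \<in> S \<and> s' \<in> S \<and> s < s' \<and> {s<..<s'} \<inter> S = {}"

lemma ex_consecutive_right:
  assumes "finite S" "s \<in> S" "b \<in> S" "s < b"
  obtains s' where "consecutive S s s'"
proof -
  let ?T = "{t \<in> S. s < t}"
  have T: "finite ?T" "?T \<noteq> {}" using assms by auto
  have "Min ?T \<in> ?T" by (rule Min_in[OF T])
  moreover have "t \<notin> S" if "s < t" "t < Min ?T" for t using that Min_le[OF T(1), of t] by auto
  ultimately show thesis using that[of "Min ?T"] assms(2)
      by (auto simp: consecutive_def disjoint_iff)
qed

lemma ex_consecutive_left: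
  assumes "finite S" "s \<in> S" "a \<in> S" "a < s"
  obtains s' where "consecutive S s' s"
proof -
  let ?T = "{t \<in> S. t < s}"
  have T: "finite ?T" "?T \<noteq> {}" using assms by auto
  have "Max ?T \<in> ?T" by (rule Max_in[OF T])
  moreover have "t \<notin> S" if "t < s" "Max ?T < t" for t using that Max_ge[OF T(1), of t] by auto
  ultimately show thesis using that[of "Max ?T"] assms(2)
      by (auto simp: consecutive_def disjoint_iff)
qed

lemma ex_consecutive_around:
  fixes R :: "real \<Rightarrow> int"
  assumes "finite S" "strict_mono_on S R" "a \<in> S" "b \<in> S" "R a < j" "j < R b" "j \<notin> R ` S"
  obtains s s' where "consecutive S s s'" "R s < j" "j < R s'"
proof -
  let ?T = "{t \<in> S. R t \<le> j}"
  have T: "finite ?T" "?T \<noteq> {}" using assms by auto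
  define s where "s = Max ?T"
  have s: "s \<in> S" "R s \<le> j" using Max_in[OF T] by (auto simp: s_def)
  then have "R s < j" using assms(7) by (metis image_eqI order_le_less)
  have "s < b"
  proof (rule ccontr)
    assume "\<not> s < b"
    then have "R b \<le> R s" using strict_mono_on_leD[OF assms(2,4) s(1)] by simp
    then show False using \<open>R s < j\<close> assms(6) by linarith
  qed
  then obtain s' where s': "consecutive S s s'"
      using ex_consecutive_right[OF assms(1) s(1) assms(4)] by blast
  have "\<not> R s' \<le> j"
    using Max_ge[OF T(1), of s'] s' by (auto simp: consecutive_def s_def)
  then show thesis using that[OF s' \<open>R s < j\<close>] by simp
qed

text \<open>Linear interpolation of the values \<open>V s\<close> placed at the integers
  \<open>R s\<close>. By \<open>rel\<close> the line on each cell arrives at the value where the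
  next one starts.\<close>

lemma integer_interpolation:
  fixes R V :: "real \<Rightarrow> int"
  assumes fin: "finite S" and mono: "strict_mono_on S R"
    and rel: "\<And>s s'. consecutive S s s' \<Longrightarrow> V s' - V s = m s * (R s' - R s)"
  obtains X where "\<And>s j. s \<in> S \<Longrightarrow> R s = int j \<Longrightarrow> X j = V s"
    "\<And>s s' j. consecutive S s s' \<Longrightarrow> R s \<le> int j \<Longrightarrow> int j < R s' \<Longrightarrow> X (Suc j) - X j = m s"
proof -
  \<comment> \<open>The last breakpoint whose image does not exceed \<open>j\<close>, that is, the
    left end of the cell containing \<open>j\<close>.\<close>
  define seg where "seg j = Max {s \<in> S. R s \<le> int j}" for j
  define X where "X j = V (seg j) + m (seg j) * (int j - R (seg j))" for j
  have seg: "seg j = s" if "s \<in> S" "R s \<le> int j" "\<And>t. t \<in> S \<Longrightarrow> s < t \<Longrightarrow> int j < R t" for s j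
    unfolding seg_def
  proof (rule Max_eqI)
    fix t assume "t \<in> {s \<in> S. R s \<le> int j}"
    then show "t \<le> s" using that(3)[of t] by force
  qed (use fin that in auto)
  have X: "X j = V s" if "s \<in> S" "R s = int j" for s j
  proof -
    have "seg j = s" using that mono by (intro seg) (auto dest: strict_mono_onD)
    then show ?thesis using that by (simp add: X_def)
  qed
  have "X (Suc j) - X j = m s" if c: "consecutive S s s'" "R s \<le> int j" "int j < R s'" for s s' j
  proof -
    have s: "s \<in> S" "s' \<in> S" using c by (auto simp: consecutive_def)
    have above: "R s' \<le> R t" if "t \<in> S" "s < t" for t
    proof (cases "t = s'")
      case False
      then have "s' < t" using c(1) that by (force simp: consecutive_def)
      then show ?thesis using mono s that by (force dest: strict_mono_onD)
    qed simp
    have "seg j = s" using c s above by (intro seg) fastforce+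
    then have Xj: "X j = V s + m s * (int j - R s)" by (simp add: X_def)
    show ?thesis
    proof (cases "R s' = int (Suc j)")
      case True
      then have "X (Suc j) = V s'" using X s by blast
      then show ?thesis using Xj rel[OF c(1)] True by (simp add: algebra_simps)
    next
      case False
      then have "seg (Suc j) = s" using c s above by (intro seg) fastforce+
      then have "X (Suc j) = V s + m s * (int (Suc j) - R s)" by (simp add: X_def)
      then show ?thesis using Xj by (simp add: algebra_simps)
    qed
  qed
  then show thesis using that X by blast
qed

section \<open>Moving a divisor and its witnesses onto the grid\<close>

context subdivided_graph
begin

definition round_point :: "(real \<Rightarrow> int) \<Rightarrow> ('a, 'b) mpoint \<Rightarrow> 'a + 'b \<times> nat" where
  "round_point R = map_sum id (\<lambda>(e, t). (e, nat (R t)))"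

lemma round_point_simps [simp]:
  "round_point R (Inl v) = Inl v" "round_point R (Inr (e, t)) = Inr (e, nat (R t))"
  by (simp_all add: round_point_def)

text \<open>\<open>R\<close> stands for rounding \<open>k * t\<close>. On positions it has to be
  increasing and exact at both ends; on function values only the relation \<open>rel\<close> of
  \<open>winnable_round_point\<close> is asked of it.\<close>

context
  fixes S :: "real set" and R :: "real \<Rightarrow> int"
  assumes S: "finite S" "S \<subseteq> {0..1}" "0 \<in> S" "1 \<in> S"
    and R: "strict_mono_on S R" "R 0 = 0" "R 1 = int k"
begin

lemma R_range: "s \<in> S \<Longrightarrow> 0 < s \<Longrightarrow> s < 1 \<Longrightarrow> 0 < R s \<and> R s < int k"
  using strict_mono_onD[OF R(1), of 0 s] strict_mono_onD[OF R(1), of s 1] S R by auto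

lemma inj_round_point: "inj_on (round_point R) (Inl ` UNIV \<union> Inr ` (UNIV \<times> S))"
proof -
  have "0 \<le> R s" if "s \<in> S" for s
    using strict_mono_onD[OF R(1), of 0 s] that S R by (cases "s = 0") force+
  then have "s = t" if "s \<in> S" "t \<in> S" "nat (R s) = nat (R t)" for s t
    using that strict_mono_on_imp_inj_on[OF R(1)] by (metis eq_nat_nat_iff inj_onD)
  then show ?thesis by (auto simp: inj_on_def)
qed

lemma round_point_in_verts:
  assumes "p \<in> P" "p \<in> Inl ` UNIV \<union> Inr ` (UNIV \<times> S)" shows "round_point R p \<in> verts H"
  using assms(1)
proof (cases p rule: points_cases)
  case (vertex v)
  then show ?thesis by (simp add: H_simps)
next
  case (interior e t)
  then have "0 < R t \<and> R t < int k" using R_range[of t] assms(2) by auto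
  then show ?thesis using interior by (auto simp: H_simps)
qed

text \<open>
  Moving the breakpoints \<open>s\<close> to \<open>R s / k\<close> while keeping all slopes yields a function on the
  subdivision with the same slope sums, provided that \<open>R\<close> respects the linear relations between the
  breakpoints and the values of the function.
\<close>

lemma winnable_round_point:
  assumes C: "C \<in> divisors P" "\<And>e t. Inr (e, t) \<in> Poly_Mapping.keys C \<Longrightarrow> t \<in> S"
    and f: "regular f" "\<And>p. p \<in> P \<Longrightarrow> 0 \<le> of_int (Poly_Mapping.lookup C p) + slope_sum f p"
    and lin: "\<And>e s s' t. e \<in> arcs G \<Longrightarrow> consecutive S s s' \<Longrightarrow> s \<le> t \<Longrightarrow> t \<le> s' \<Longrightarrow>
      f (pt e t) = f (pt e s) + of_int (m e s) * (t - s)"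
    and rel: "\<And>e s s'. e \<in> arcs G \<Longrightarrow> consecutive S s s' \<Longrightarrow>
      R (f (pt e s')) - R (f (pt e s)) = m e s * (R s' - R s)"
  shows "winnable P Prin (push_divisor embed (push_divisor (round_point R) C))"
proof -
  let ?A = "Inl ` UNIV \<union> Inr ` (UNIV \<times> S) :: ('a, 'b) mpoint set"
  have keys: "Poly_Mapping.keys C \<subseteq> ?A"
  proof
    fix p assume "p \<in> Poly_Mapping.keys C"
    then show "p \<in> ?A" using C(2) by (cases p) auto
  qed
  define C' where "C' = push_divisor (round_point R) C"
  have C': "C' \<in> divisors (verts H)"
    unfolding C'_def
  proof (rule push_divisor_in_divisors[of C "Poly_Mapping.keys C"])
    fix p assume "p \<in> Poly_Mapping.keys C"
    then show "round_point R p \<in> verts H"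
      using keys C(1) by (intro round_point_in_verts) (auto simp: divisors_def)
  qed (simp add: divisors_def)
  have lookup: "Poly_Mapping.lookup C' (round_point R p) = Poly_Mapping.lookup C p"
      if "p \<in> ?A" for p
    unfolding C'_def by (rule lookup_push_divisor_inj[OF inj_round_point keys that])
  have "\<exists>X. (\<forall>s\<in>S. \<forall>j. R s = int j \<longrightarrow> X j = R (f (pt e s))) \<and>
      (\<forall>s s' j. consecutive S s s' \<longrightarrow> R s \<le> int j \<longrightarrow> int j < R s' \<longrightarrow> X (Suc j) - X j = m e s)"
    if "e \<in> arcs G" for e
    by (rule integer_interpolation[OF S(1) R(1) rel[OF that]]) blast+
  then obtain X where X: "\<And>e s j. e \<in> arcs G \<Longrightarrow> s \<in> S \<Longrightarrow> R s = int j \<Longrightarrow> X e j = R (f (pt e s))"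
    and X_Suc: "\<And>e s s' j. e \<in> arcs G \<Longrightarrow> consecutive S s s' \<Longrightarrow> R s \<le> int j \<Longrightarrow> int j < R s' \<Longrightarrow>
      X e (Suc j) - X e j = m e s"
    by metis
  define x where "x = case_sum (\<lambda>v. R (f (Inl v))) (\<lambda>(e, j). X e j)"
  \<comment> \<open>Since 0 and 1 are breakpoints, the interpolations on all edges at a vertex
    \<open>v\<close> take the value \<open>R (f (Inl v))\<close> there.\<close>
  have x_sv: "x (sv e j) = X e j" if "e \<in> arcs G" for e j
    using X[OF that S(3), of 0] X[OF that S(4), of k] R k
    by (auto simp: x_def subdivision_vertex_def edge_point_def)
  have right: "slope (\<lambda>t. f (pt e t)) s 1 = of_int (X e (Suc j) - X e j)"
    if e: "e \<in> arcs G" and s: "s \<in> S" "s < 1" "R s = int j" for e s j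
  proof -
    obtain s' where s': "consecutive S s s'" using ex_consecutive_right[OF S(1) s(1) S(4) s(2)] .
    then have "s < s'" "int j < R s'"
      using R(1) s by (auto simp: consecutive_def dest: strict_mono_onD)
    then show ?thesis
      using slope_eq[OF germ_linear_right[of s s' "\<lambda>t. f (pt e t)" "m e s" s, OF lin[OF e s']]]
          X_Suc[OF e s'] s by simp
  qed
  have left: "slope (\<lambda>t. f (pt e t)) s (-1) = of_int (X e (j - 1) - X e j)"
    if e: "e \<in> arcs G" and s: "s \<in> S" "0 < s" "R s = int j" for e s j
  proof -
    obtain s' where s': "consecutive S s' s" using ex_consecutive_left[OF S(1) s(1) S(3) s(2)] .
    then have "s' < s" "R s' < int j" "s' \<in> S"
      using R(1) s by (auto simp: consecutive_def dest: strict_mono_onD)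
    \<comment> \<open>Forces \<open>0 < j\<close>, so that \<open>j - 1\<close> is a true
      predecessor in \<open>nat\<close>.\<close>
    moreover have "0 \<le> R s'"
      using strict_mono_onD[OF R(1), of 0 s'] S R(2) \<open>s' \<in> S\<close> by (cases "s' = 0") force+
    ultimately have "X e (Suc (j - 1)) - X e (j - 1) = m e s'" "0 < j"
      using X_Suc[OF e s', of "j - 1"] s by auto
    then show ?thesis
      using slope_eq[OF germ_linear_left[of s' s "\<lambda>t. f (pt e t)" "m e s'" s, OF lin[OF e s']]]
          \<open>s' < s\<close> by simp
  qed
  have "0 \<le> Poly_Mapping.lookup C' u + flow H x u" if "u \<in> verts H" for u
    using that
  proof (cases u rule: verts_H_cases)
    case (vertex v)
    have "(0 :: real) \<le> of_int (Poly_Mapping.lookup C (Inl v)) + slope_sum f (Inl v)"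
      using f(2)[of "Inl v"] vertex by (simp add: points_def)
    also have "slope_sum f (Inl v) = of_int (flow H x (Inl v))"
      unfolding slope_sum_Inl flow_Inl of_int_add of_int_sum
      using right[of _ 0 0] left[of _ 1 k] S R
          by (intro arg_cong2[of _ _ _ _ "(+)"] sum.cong) (auto simp: x_sv)
    finally show ?thesis
      using lookup[of "Inl v"] vertex by (simp flip: of_int_add)
  next
    case (interior e j)
    show ?thesis
    proof (cases "int j \<in> R ` S")
      case True
      then obtain s where s: "s \<in> S" "R s = int j" by auto
      then have s01: "0 < s" "s < 1" using interior S(2) R by (auto simp: order_le_less)
      have "(0 :: real) \<le> of_int (Poly_Mapping.lookup C (Inr (e, s))) + slope_sum f (Inr (e, s))"
        using f(2)[of "Inr (e, s)"] interior s01 by (simp add: points_def)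
      also have "slope_sum f (Inr (e, s)) = of_int (flow H x u)"
        using interior s01 right[of e s j] left[of e s j] s
            by (simp add: slope_sum_Inr flow_Inr x_sv)
      finally show ?thesis
        using lookup[of "Inr (e, s)"] interior s by (simp flip: of_int_add)
    next
      \<comment> \<open>Strictly between images of consecutive breakpoints, the interpolation is
        linear and no chip has been moved there.\<close>
      case False
      obtain s s' where s: "consecutive S s s'" "R s < int j" "int j < R s'"
        by (rule ex_consecutive_around[OF S(1) R(1) S(3,4), of "int j"])
            (use interior R False in auto)
      have "X e (Suc j) - X e j = m e s" "X e (Suc (j - 1)) - X e (j - 1) = m e s"
        using X_Suc[OF interior(2) s(1), of j] X_Suc[OF interior(2) s(1), of "j - 1"]
            s(2,3) interior(3) by auto
      then have "flow H x u = 0" using interior by (simp add: flow_Inr x_sv)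
      moreover have "u \<notin> round_point R ` Poly_Mapping.keys C"
      proof
        assume "u \<in> round_point R ` Poly_Mapping.keys C"
        then obtain p where p: "p \<in> Poly_Mapping.keys C" "round_point R p = u" by auto
        then obtain t where t: "p = Inr (e, t)" "nat (R t) = j"
          using interior by (cases p) auto
        then have "t \<in> S" using C(2) p(1) by simp
        then show False using False interior t(2) by force
      qed
      ultimately show ?thesis by (simp add: C'_def lookup_push_divisor_notin)
    qed
  qed
  then have "winnable (verts H) (principal_divisors H) C'"
    using winnable_graph_iff[OF fin_H loopfree_H C'] by blast
  then show ?thesis using winnable_push_embed[OF C'] by (simp add: C'_def)
qed

end

text \<open>Rounding fixes the vertices of \<open>G\<close>, so the test divisors are the same
  before and after.\<close>

lemma push_embed_round_point:
  assumes "E \<in> divisors (Inl ` verts G)"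
  shows "push_divisor embed (push_divisor (round_point R) E) = E"
proof -
  have inj: "inj_on (round_point R) (range Inl)" by (auto simp: inj_on_def)
  have keys: "Poly_Mapping.keys E \<subseteq> range Inl" using assms by (auto simp: divisors_def)
  show ?thesis
  proof (rule poly_mapping_eqI)
    fix p
    show "Poly_Mapping.lookup (push_divisor embed (push_divisor (round_point R) E)) p = Poly_Mapping.lookup E p"
    proof (cases p)
      case (Inl v)
      then show ?thesis
        using lookup_push_embed[of "push_divisor (round_point R) E" "Inl v"]
          lookup_push_divisor_inj[OF inj keys, of "Inl v"] by simp
    next
      case (Inr et)
      have "push_divisor (round_point R) E \<in> divisors (Inl ` verts G)"
        using assms by (rule push_divisor_in_divisors) auto
      then have "Inr et \<notin> embed ` Poly_Mapping.keys (push_divisor (round_point R) E)"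
        by (auto simp: divisors_def)
      then show ?thesis
        using Inr divisors_lookup_eq_0[OF assms, of p] by (auto simp: lookup_push_divisor_notin)
    qed
  qed
qed

end

section \<open>Choosing the subdivision for a given divisor\<close>

context loopfree_unit_metric_graph
begin

lemma rank_ge_subdivision:
  assumes D: "D \<in> divisors (points G (\<lambda>_. 1))"
    and rank: "rank_ge (points G (\<lambda>_. 1)) (metric_principal_divisors G (\<lambda>_. 1)) D r"
  obtains k D' where "0 < k" "D' \<in> divisors (verts (subdivide_edges k G))"
      "div_degree D' = div_degree D"
    "rank_ge (verts (subdivide_edges k G)) (principal_divisors (subdivide_edges k G)) D' r"
proof -
  let ?P = "points G (\<lambda>_. 1)" and ?W = "winnable (points G (\<lambda>_. 1)) (metric_principal_divisors G (\<lambda>_. 1))"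
  define \<E> :: "('a, 'b) mpoint divisor set" where
    "\<E> = {E \<in> divisors (Inl ` verts G). effective E \<and> div_degree E = r}"
  have fin_E: "finite \<E>" unfolding \<E>_def by (rule finite_effective_divisors) simp
  have vert: "Inl ` verts G \<subseteq> ?P" by (auto simp: points_def)
  have E_div: "D - E \<in> divisors ?P" if "E \<in> \<E>" for E
    using that D vert by (intro divisors_diff) (auto simp: \<E>_def divisors_def)
  have "\<exists>f. regular f \<and> (\<forall>p\<in>?P. 0 \<le> of_int (Poly_Mapping.lookup (D - E) p) + slope_sum f p)"
    if "E \<in> \<E>" for E
  proof -
    have "E \<in> divisors ?P" using that vert by (auto simp: \<E>_def divisors_def)
    then have "?W (D - E)" using rank that by (simp add: rank_ge_def \<E>_def)
    then show ?thesis using winnable_iff[OF E_div[OF that]] by blast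
  qed
  then obtain F where F: "\<And>E. E \<in> \<E> \<Longrightarrow> regular (F E)"
    "\<And>E p. E \<in> \<E> \<Longrightarrow> p \<in> ?P \<Longrightarrow> 0 \<le> of_int (Poly_Mapping.lookup (D - E) p) + slope_sum (F E) p"
    by metis
  have "\<exists>B. finite B \<and> (\<forall>a b. 0 \<le> a \<longrightarrow> a < b \<longrightarrow> b \<le> 1 \<longrightarrow> {a<..<b} \<inter> B = {} \<longrightarrow>
      (\<exists>m :: int. \<forall>t\<in>{a..b}. F E (pt e t) = F E (pt e a) + of_int m * (t - a)))"
    if "E \<in> \<E>" "e \<in> arcs G" for E e
  proof -
    have "piecewise_linear_int_slopes 1 (\<lambda>t. F E (pt e t))"
      using F(1)[OF that(1)] that(2) by (simp add: regular_def piecewise_linear_iff_has_germs)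
    then show ?thesis by (rule piecewise_linear_breakpoints) blast
  qed
  then obtain B where B: "\<And>E e. E \<in> \<E> \<Longrightarrow> e \<in> arcs G \<Longrightarrow> finite (B E e)"
    "\<And>E e a b. E \<in> \<E> \<Longrightarrow> e \<in> arcs G \<Longrightarrow> 0 \<le> a \<Longrightarrow> a < b \<Longrightarrow> b \<le> 1 \<Longrightarrow> {a<..<b} \<inter> B E e = {} \<Longrightarrow>
      \<exists>m :: int. \<forall>t\<in>{a..b}. F E (pt e t) = F E (pt e a) + of_int m * (t - a)"
    by metis
  \<comment> \<open>One set of parameters serves all edges and witnesses: extra breakpoints do no
    harm, and \<open>R\<close> need be increasing on one set only.\<close>
  define S where "S = {0..1} \<inter> ({0, 1} \<union> (\<lambda>p. case p of Inl v \<Rightarrow> 0 | Inr (e, t) \<Rightarrow> t) `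
      Poly_Mapping.keys D \<union>
    (\<Union>E\<in>\<E>. \<Union>e\<in>arcs G. B E e))"
  have S: "finite S" "S \<subseteq> {0..1}" "0 \<in> S" "1 \<in> S"
    using fin_E B(1) by (auto simp: S_def)
  have S_keys: "t \<in> S" if "Inr (e, t) \<in> Poly_Mapping.keys D" for e t
    using that D by (force simp: S_def divisors_def points_def)
  have "\<exists>m :: int. \<forall>t\<in>{s..s'}. F E (pt e t) = F E (pt e s) + of_int m * (t - s)"
    if "E \<in> \<E>" "e \<in> arcs G" "consecutive S s s'" for E e s s'
  proof -
    have "0 \<le> s" "s < s'" "s' \<le> 1" using that S(2) by (auto simp: consecutive_def)
    moreover have "B E e \<inter> {0..1} \<subseteq> S" using that(1,2) by (auto simp: S_def)
    ultimately have "{s<..<s'} \<inter> B E e = {}"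
      using that(3) by (fastforce simp: consecutive_def)
    then show ?thesis using B(2)[OF that(1,2) \<open>0 \<le> s\<close> \<open>s < s'\<close> \<open>s' \<le> 1\<close>] by blast
  qed
  then obtain m' where m': "\<And>E e s s' t. E \<in> \<E> \<Longrightarrow> e \<in> arcs G \<Longrightarrow> consecutive S s s' \<Longrightarrow> t \<in> {s..s'} \<Longrightarrow>
      F E (pt e t) = F E (pt e s) + of_int (m' E e s s') * (t - s)"
    by metis
  \<comment> \<open>Indexing slopes by the left end alone is the form that
    \<open>integer_interpolation\<close> expects; the right end is recovered as the next
    breakpoint.\<close>
  define m where "m E e s = m' E e s (THE s'. consecutive S s s')" for E e s
  have next_eq: "(THE s'. consecutive S s s') = s'" if "consecutive S s s'" for s s'
    using that by (intro the_equality) (force simp: consecutive_def)+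
  have m: "F E (pt e t) = F E (pt e s) + of_int (m E e s) * (t - s)"
    if "E \<in> \<E>" "e \<in> arcs G" "consecutive S s s'" "s \<le> t" "t \<le> s'" for E e s s' t
    using m'[OF that(1-3), of t] that(4,5) unfolding m_def next_eq[OF that(3)] by simp
  \<comment> \<open>The inserted 0 makes the maximum exist and be nonnegative even without edges or
    test divisors.\<close>
  define Z where "Z = insert 0 ((\<lambda>(E, e, s). \<bar>real_of_int (m E e s)\<bar>) ` (\<E> \<times> arcs G \<times> S))"
  define M where "M = Max Z"
  have "finite Z" using fin_E S(1) by (simp add: Z_def)
  have M: "\<bar>real_of_int (m E e s)\<bar> \<le> M" if "E \<in> \<E>" "e \<in> arcs G" "s \<in> S" for E e s
    unfolding M_def using that by (intro Max_ge[OF \<open>finite Z\<close>]) (force simp: Z_def)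
  have M0: "0 \<le> M" unfolding M_def by (rule Max_ge[OF \<open>finite Z\<close>]) (simp add: Z_def)
  define \<Delta> where "\<Delta> = insert 1 ((\<lambda>(s, s'). s' - s) ` {(s, s'). s \<in> S \<and> s' \<in> S \<and> s < s'})"
  define \<gamma> where "\<gamma> = Min \<Delta>"
  have "{(s, s'). s \<in> S \<and> s' \<in> S \<and> s < s'} \<subseteq> S \<times> S" by auto
  then have "finite \<Delta>" unfolding \<Delta>_def using finite_subset S(1) by blast
  have "\<gamma> \<in> \<Delta>" unfolding \<gamma>_def by (rule Min_in[OF \<open>finite \<Delta>\<close>]) (simp add: \<Delta>_def)
  then have "0 < \<gamma>" by (auto simp: \<Delta>_def)
  have gap: "\<gamma> \<le> s' - s" if "s \<in> S" "s' \<in> S" "s < s'" for s s'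
    unfolding \<gamma>_def using that by (intro Min_le[OF \<open>finite \<Delta>\<close>]) (force simp: \<Delta>_def)
  define X where "X = S \<union> (\<lambda>(E, e, s). F E (pt e s)) ` (\<E> \<times> arcs G \<times> S)"
  have S_X: "s \<in> X" if "s \<in> S" for s using that by (simp add: X_def)
  have value_X: "F E (pt e s) \<in> X" if "E \<in> \<E>" "e \<in> arcs G" "s \<in> S" for E e s
    unfolding X_def using that by (intro UnI2 image_eqI[of _ _ "(E, e, s)"]) auto
  have "finite X" using S(1) fin_E by (simp add: X_def)
  \<comment> \<open>With errors below \<open>\<gamma> / 2\<close> two rounded breakpoints stay in
    order, as their distance was at least \<open>\<gamma>\<close> even before scaling by
    \<open>k\<close>. The other bound is for \<open>R_rel\<close>: two errors of values and two of
    positions, the latter times a slope of size at most \<open>M\<close>, total less than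
    \<open>\<epsilon> * (2 + 2 * M) \<le> 1\<close>.\<close>
  define \<epsilon> where "\<epsilon> = min (\<gamma> / 2) (1 / (2 + 2 * M))"
  have "0 < \<epsilon>" using \<open>0 < \<gamma>\<close> M0 by (simp add: \<epsilon>_def)
  obtain k :: nat where k: "0 < k" "\<And>x. x \<in> X \<Longrightarrow> \<bar>of_int (round (real k * x)) - real k * x\<bar> < \<epsilon>"
    using simultaneous_rounding[OF \<open>finite X\<close> \<open>0 < \<epsilon>\<close>] by blast
  define R where "R x = round (real k * x)" for x
  have R: "\<bar>of_int (R x) - real k * x\<bar> < \<epsilon>" if "x \<in> X" for x using k(2)[OF that]
      by (simp add: R_def)
  have R_mono: "strict_mono_on S R"
  proof (rule strict_mono_onI)
    fix s s' assume s: "s \<in> S" "s' \<in> S" "s < s'"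
    have "\<gamma> \<le> real k * (s' - s)"
    proof -
      have "1 * (s' - s) \<le> real k * (s' - s)" using k(1) s by (intro mult_right_mono) auto
      then show ?thesis using gap[OF s] by simp
    qed
    moreover have "2 * \<epsilon> \<le> \<gamma>" by (simp add: \<epsilon>_def)
    ultimately have "real_of_int (R s) < of_int (R s')"
      using R[of s] R[of s'] s by (simp add: X_def algebra_simps)
    then show "R s < R s'" by simp
  qed
  have R01: "R 0 = 0" "R 1 = int k" by (simp_all add: R_def)
  text \<open>A linear relation between integers that holds up to an error less than 1 is exact.\<close>
  have R_rel: "R (F E (pt e s')) - R (F E (pt e s)) = m E e s * (R s' - R s)"
    if E: "E \<in> \<E>" and e: "e \<in> arcs G" and c: "consecutive S s s'" for E e s s'
  proof -
    have s: "s \<in> S" "s' \<in> S" "s \<le> s'" using c by (auto simp: consecutive_def)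
    define \<delta> where "\<delta> x = of_int (R x) - real k * x" for x
    have \<delta>: "\<bar>\<delta> (F E (pt e s))\<bar> < \<epsilon>" "\<bar>\<delta> (F E (pt e s'))\<bar> < \<epsilon>" "\<bar>\<delta> s\<bar> < \<epsilon>" "\<bar>\<delta> s'\<bar> < \<epsilon>"
      unfolding \<delta>_def using s E e by (simp_all only: R S_X value_X)
    define d where "d = R (F E (pt e s')) - R (F E (pt e s)) - m E e s * (R s' - R s)"
    have lin: "F E (pt e s') = F E (pt e s) + of_int (m E e s) * (s' - s)"
      by (rule m[OF E e c s(3) order_refl])
    have "real_of_int d = \<delta> (F E (pt e s')) - \<delta> (F E (pt e s)) - of_int (m E e s) * (\<delta> s' - \<delta> s)"
      unfolding d_def \<delta>_def lin by (simp add: algebra_simps)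
    moreover have "\<bar>of_int (m E e s) * (\<delta> s' - \<delta> s)\<bar> \<le> M * (2 * \<epsilon>)"
      unfolding abs_mult using M[OF E e s(1)] \<delta> M0 by (intro mult_mono) auto
    ultimately have "\<bar>real_of_int d\<bar> < 2 * \<epsilon> + M * (2 * \<epsilon>)" using \<delta> by linarith
    also have "\<dots> = \<epsilon> * (2 + 2 * M)" by (simp add: algebra_simps)
    also have "\<dots> \<le> 1"
    proof -
      have "\<epsilon> \<le> 1 / (2 + 2 * M)" by (simp add: \<epsilon>_def)
      then show ?thesis using M0 by (simp add: pos_le_divide_eq)
    qed
    finally have "d = 0" by linarith
    then show ?thesis by (simp add: d_def)
  qed
  interpret subdivided_graph G k by unfold_locales (rule k(1))
  define D' where "D' = push_divisor (round_point R) D"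
  have D': "D' \<in> divisors (verts H)"
    unfolding D'_def
  proof (rule push_divisor_in_divisors[of D "Poly_Mapping.keys D"])
    fix p assume p: "p \<in> Poly_Mapping.keys D"
    then have "p \<in> Inl ` UNIV \<union> Inr ` (UNIV \<times> S)" using S_keys by (cases p) auto
    then show "round_point R p \<in> verts H"
      using p D by (intro round_point_in_verts[OF S R_mono R01]) (auto simp: divisors_def)
  qed (simp add: divisors_def)
  \<comment> \<open>The detour through the metric graph is taken because that is where V(G) is known
    to determine the rank.\<close>
  have "rank_ge ?P Prin (push_divisor embed D') r"
  proof (rule rank_ge_of_subset[OF vert push_embed_in_divisors[OF D']])
    fix E assume "E \<in> divisors (Inl ` verts G :: ('a, 'b) mpoint set)" "effective E"
        "div_degree E = r"
    then have E: "E \<in> \<E>" by (simp add: \<E>_def)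
    have "?W (push_divisor embed (push_divisor (round_point R) (D - E)))"
    proof (rule winnable_round_point[OF S R_mono R01 E_div[OF E] _ F(1)[OF E] F(2)[OF E] m[OF E]
        R_rel[OF E]])
      fix e t assume "Inr (e, t) \<in> Poly_Mapping.keys (D - E)"
      moreover have "Inr (e, t) \<notin> Poly_Mapping.keys E" using E by (auto simp: \<E>_def divisors_def)
      ultimately show "t \<in> S" using S_keys by (auto simp: in_keys_iff lookup_minus)
    qed
    then show "?W (push_divisor embed D' - E)"
      using E unfolding push_divisor_diff D'_def by (simp add: push_embed_round_point \<E>_def)
  qed (rule winnable_of_vertices)
  then show thesis
    using that[of k D'] k(1) D' rank_ge_push_embed_iff[OF D'] by (simp add: D'_def)
qed

end

theorem theorem1p3:
  fixes G :: "('a, 'b) pre_digraph" and r :: int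
  assumes "fin_digraph G" and "loopfree_digraph G" and "Digraph_Component.connected G"
    and "r \<ge> 1"
  shows "(\<exists>k::nat. k \<ge> 1 \<and> metric_dgon G (\<lambda>_. 1) r = graph_dgon (subdivide_edges k G) r) \<and>
         (\<forall>k::nat. k \<ge> 1 \<longrightarrow> metric_dgon G (\<lambda>_. 1) r \<le> graph_dgon (subdivide_edges k G) r)"
proof -
  interpret fin_digraph G by (rule assms(1))
  interpret loopfree_digraph G by (rule assms(2))
  interpret loopfree_unit_metric_graph G
    by unfold_locales (use assms(3) in auto)
  have sub: "subdivided_graph G k" if "k \<ge> 1" for k
    using that by unfold_locales simp
  \<comment> \<open>\<open>ex\<close> makes the gonality of the metric graph a true minimum: a
    divisor of rank at least \<open>r\<close> on any subdivision is pushed into it.\<close>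
  have le: "metric_dgon G (\<lambda>_. 1) r \<le> graph_dgon (subdivide_edges k G) r"
    and ex: "\<exists>D \<in> divisors (points G (\<lambda>_. 1)). rank_ge (points G (\<lambda>_. 1)) (metric_principal_divisors G (\<lambda>_. 1)) D r"
    if "k \<ge> 1" for k
  proof -
    interpret subdivided_graph G k by (rule sub[OF that])
    obtain D0 where D0: "D0 \<in> divisors (verts H)" "rank_ge (verts H) (principal_divisors H) D0 r"
      using ex_rank_ge[of r] assms(4) by auto
    obtain D where D: "D \<in> divisors (verts H)" "rank_ge (verts H) (principal_divisors H) D r"
      "div_degree D = graph_dgon H r"
      using H.dgon_least(1)[OF _ D0] assms(4) unfolding graph_dgon_def by auto
    have D': "push_divisor embed D \<in> divisors P" "rank_ge P Prin (push_divisor embed D) r"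
      using D push_embed_in_divisors rank_ge_push_embed_iff by auto
    then show "\<exists>D \<in> divisors P. rank_ge P Prin D r" by blast
    show "metric_dgon G (\<lambda>_. 1) r \<le> graph_dgon H r"
      using dgon_least(2)[OF _ D' D'] D(3) assms(4) unfolding metric_dgon_def by simp
  qed
  obtain D where D: "D \<in> divisors (points G (\<lambda>_. 1))"
    "rank_ge (points G (\<lambda>_. 1)) (metric_principal_divisors G (\<lambda>_. 1)) D r"
    "div_degree D = metric_dgon G (\<lambda>_. 1) r"
    using ex[of 1] dgon_least(1)[of r] assms(4) unfolding metric_dgon_def by auto
  obtain k D' where kD: "0 < k" "D' \<in> divisors (verts (subdivide_edges k G))"
      "div_degree D' = div_degree D"
    "rank_ge (verts (subdivide_edges k G)) (principal_divisors (subdivide_edges k G)) D' r"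
    using rank_ge_subdivision[OF D(1,2)] .
  interpret subdivided_graph G k using kD(1) by (intro sub) simp
  have "graph_dgon H r \<le> metric_dgon G (\<lambda>_. 1) r"
    using H.dgon_least(2)[OF _ kD(2,4) kD(2,4)] kD(3) D(3) assms(4) unfolding graph_dgon_def by simp
  then show ?thesis using le kD(1) by (metis One_nat_def Suc_leI antisym)
qed

end
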